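(* Let $\mathcal{H}$ be a separable reproducing kernel Hilbert space of complex-valued functions on a nonempty set $\Omega$, with reproducing kernel $K:\Omega\times\Omega\to\mathbb{C}$, $K(z,\lambda)=K_\lambda(z)$. Let $L\in\mathcal{L}(\mathcal{H})$, and let $\{\lambda_n\}_{n=1}^{\infty}\subset\Omega$ be a sequence with $\lambda_n\neq\lambda_m$ for $n\neq m$ and $K_{\lambda_n}\neq 0$ for all $n$. Then the following statements are equivalent: (i) $\left\{\frac{K_{\lambda_n}}{\|K_{\lambda_n}\|}\right\}_{n=1}^{\infty}$ is an atomic system for $L$, i.e. the series $\sum_{n=1}^{\infty} c_n\frac{K_{\lambda_n}}{\|K_{\lambda_n}\|}$ converges for all $\{c_n\}\in l^2$, and there exists $C>0$ such that for every $f\in\mathcal{H}$ there exists $a_f=(a_n)\in l^2$ with $\|a_f\|_{l^2}\leq C\|f\|$ and $Lf=\sum_{n=1}^{\infty} a_n\frac{K_{\lambda_n}}{\|K_{\lambda_n}\|}$; (ii) there exist $A,B>0$ such that $$A\|L^{*}f\|^2\leq \sum_{n=1}^{\infty} \frac{|f(\lambda_n)|^2}{\|K_{\lambda_n}\|^2}\leq B\|f\|^2\quad\text{for all } f\in\mathcal{H};$$ (iii) $\left\{\frac{K_{\lambda_n}}{\|K_{\lambda_n}\|}\right\}_{n=1}^{\infty}$ is a Bessel sequence and there exists a Bessel sequence $\{g_n\}_{n=1}^{\infty}\subset\mathcal{H}$ such that $$Lf=\sum_{n=1}^{\infty} \langle f,g_n\rangle \frac{K_{\lambda_n}}{\|K_{\lambda_n}\|}\quad\text{for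 all } f\in\mathcal{H};$$ (iv) $\sum_{n=1}^{\infty}\frac{|f(\lambda_n)|^2 }{\|K_{\lambda_n}\|^2}<\infty$ for all $f\in\mathcal{H}$, and there exists a Bessel sequence $\{g_n\}_{n=1}^{\infty}\subset\mathcal{H}$ such that $$L^*f=\sum_{n=1}^{\infty} \frac{f(\lambda_n)}{\|K_{\lambda_n}\|}g_n\quad\text{for all } f\in\mathcal{H}.$$
   Context: A reproducing kernel Hilbert space $(\mathcal{H},K)$ on $\Omega$ is a Hilbert space $\mathcal{H}$ of functions on $\Omega$ such that for every $\lambda\in\Omega$ the function $K_\lambda$ belongs to $\mathcal{H}$ and $f(\lambda)=\langle f,K_\lambda\rangle$ for every $f\in\mathcal{H}$. $\mathcal{L}(\mathcal{H})$ is the space of all bounded linear operators on $\mathcal{H}$; $L^*$ is the Hilbert space adjoint of $L$; the inner product is linear in its first argument; series of vectors converge in the norm of $\mathcal{H}$. A sequence $\{f_n\}_{n=1}^{\infty}\subset\mathcal{H}$ is a Bessel sequence if there is a constant $B>0$ such that $\sum_{n=1}^{\infty}|\langle x,f_n\rangle|^2\leq B\|x\|^2$ for all $x\in\mathcal{H}$. *)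

theory Defs
  imports "HOL-Analysis.Analysis" "HOL-Library.Function_Algebras"
begin

text \<open>
  Addition, zero and finite sums of functions are pointwise (\<open>Function_Algebras\<close>).
  A complex-valued function on a set \<open>\<Omega>\<close> is represented by the function on the ambient type
  that agrees with it on \<open>\<Omega>\<close> and vanishes outside; on these representatives pointwise
  operations and equality are those of functions on \<open>\<Omega>\<close>.
\<close>

definition cscale :: "complex \<Rightarrow> ('a \<Rightarrow> complex) \<Rightarrow> 'a \<Rightarrow> complex"  (infixr "*\<^sub>C" 75)
  where "c *\<^sub>C f = (\<lambda>x. c * f x)"

global_interpretation cfun: vector_space "cscale :: complex \<Rightarrow> ('a \<Rightarrow> complex) \<Rightarrow> 'a \<Rightarrow> complex"
  by unfold_locales (auto simp: cscale_def fun_eq_iff algebra_simps)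

definition hnorm :: "(('a \<Rightarrow> complex) \<Rightarrow> ('a \<Rightarrow> complex) \<Rightarrow> complex) \<Rightarrow> ('a \<Rightarrow> complex) \<Rightarrow> real"
  where "hnorm ip f = sqrt (Re (ip f f))"

text \<open>
  The locale \<open>Metric_space\<close> requires its distance to be nonnegative and symmetric on the whole
  type, whereas an inner product on \<open>H\<close> is unconstrained outside \<open>H\<close>; hence the case distinction.
\<close>
definition hdist :: "('a \<Rightarrow> complex) set \<Rightarrow> (('a \<Rightarrow> complex) \<Rightarrow> ('a \<Rightarrow> complex) \<Rightarrow> complex)
    \<Rightarrow> ('a \<Rightarrow> complex) \<Rightarrow> ('a \<Rightarrow> complex) \<Rightarrow> real"
  where "hdist H ip f g = (if f \<in> H \<and> g \<in> H then hnorm ip (f - g) else 0)"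

locale function_inner_space =
  fixes \<Omega> :: "'a set"
    and H :: "('a \<Rightarrow> complex) set"
    and ip :: "('a \<Rightarrow> complex) \<Rightarrow> ('a \<Rightarrow> complex) \<Rightarrow> complex"
  assumes on_Omega: "\<And>f x. \<lbrakk>f \<in> H; x \<notin> \<Omega>\<rbrakk> \<Longrightarrow> f x = 0"
    and subspace_H: "cfun.subspace H"
    and ip_add_left: "\<And>f g h. \<lbrakk>f \<in> H; g \<in> H; h \<in> H\<rbrakk> \<Longrightarrow> ip (f + g) h = ip f h + ip g h"
    and ip_scale_left: "\<And>c f g. \<lbrakk>f \<in> H; g \<in> H\<rbrakk> \<Longrightarrow> ip (c *\<^sub>C f) g = c * ip f g"
    and ip_commute: "\<And>f g. \<lbrakk>f \<in> H; g \<in> H\<rbrakk> \<Longrightarrow> ip f g = cnj (ip g f)"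
    and ip_nonneg: "\<And>f. f \<in> H \<Longrightarrow> 0 \<le> Re (ip f f)"
    and ip_definite: "\<And>f. \<lbrakk>f \<in> H; ip f f = 0\<rbrakk> \<Longrightarrow> f = 0"
begin

lemma zero_mem: "0 \<in> H"
  and add_mem: "f \<in> H \<Longrightarrow> g \<in> H \<Longrightarrow> f + g \<in> H"
  and scale_mem: "f \<in> H \<Longrightarrow> c *\<^sub>C f \<in> H"
  and diff_mem: "f \<in> H \<Longrightarrow> g \<in> H \<Longrightarrow> f - g \<in> H"
  using subspace_H cfun.subspace_0 cfun.subspace_add cfun.subspace_scale cfun.subspace_diff
  by blast+

lemma ip_add_right:
  assumes "f \<in> H" "g \<in> H" "h \<in> H"
  shows "ip h (f + g) = ip h f + ip h g"
  by (metis assms add_mem complex_cnj_add ip_add_left ip_commute)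

lemma ip_scale_right:
  assumes "f \<in> H" "g \<in> H"
  shows "ip f (c *\<^sub>C g) = cnj c * ip f g"
  by (metis assms scale_mem complex_cnj_mult ip_scale_left ip_commute)

lemma ip_self: "f \<in> H \<Longrightarrow> ip f f = of_real ((hnorm ip f)\<^sup>2)"
  using ip_commute[of f f] ip_nonneg[of f]
  by (auto simp: hnorm_def complex_eq_iff)

lemma hnorm_nonneg: "f \<in> H \<Longrightarrow> 0 \<le> hnorm ip f"
  by (simp add: hnorm_def ip_nonneg)

lemma hnorm_eq_0: "f \<in> H \<Longrightarrow> hnorm ip f = 0 \<longleftrightarrow> f = 0"
  using ip_self[of f] ip_definite[of f] ip_scale_left[of 0 0 0] zero_mem
  by (auto simp: hnorm_def)

lemma hnorm_scale:
  assumes "f \<in> H"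
  shows "hnorm ip (c *\<^sub>C f) = cmod c * hnorm ip f"
proof -
  have "ip (c *\<^sub>C f) (c *\<^sub>C f) = (c * cnj c) * ip f f"
    using assms by (simp add: ip_scale_left ip_scale_right scale_mem)
  also have "\<dots> = of_real ((cmod c * hnorm ip f)\<^sup>2)"
    unfolding ip_self[OF assms] complex_norm_square[symmetric]
    by (simp add: power_mult_distrib)
  finally have "Re (ip (c *\<^sub>C f) (c *\<^sub>C f)) = (cmod c * hnorm ip f)\<^sup>2"
    by (metis Re_complex_of_real)
  then show ?thesis
    using assms unfolding hnorm_def[of ip "c *\<^sub>C f"] by (simp add: hnorm_nonneg)
qed

lemma Cauchy_Schwarz:
  assumes f: "f \<in> H" and g: "g \<in> H"
  shows "cmod (ip f g) \<le> hnorm ip f * hnorm ip g"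
proof (cases "hnorm ip g = 0")
  case True
  then have "g = 0 *\<^sub>C g"
    using g hnorm_eq_0 by (simp add: cscale_def fun_eq_iff)
  then have "ip f g = 0"
    by (metis assms complex_cnj_zero ip_scale_right mult_zero_left)
  then show ?thesis using True by simp
next
  case False
  define N where "N = (hnorm ip g)\<^sup>2"
  have N: "N > 0" using False by (simp add: N_def)
  define c where "c = - (ip f g / of_real N)"
  have gf: "ip g f = cnj (ip f g)" using ip_commute[OF g f] .
  have "ip (f + c *\<^sub>C g) (f + c *\<^sub>C g)
      = ip f f + cnj c * ip f g + c * ip g f + c * cnj c * ip g g"
    using f g by (simp add: ip_add_left ip_add_right ip_scale_left ip_scale_right
        scale_mem add_mem algebra_simps)
  also have "\<dots> = of_real ((hnorm ip f)\<^sup>2) - ip f g * cnj (ip f g) / of_real N"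
    using N by (simp add: gf ip_self[OF f] ip_self[OF g] c_def flip: N_def)
  also have "\<dots> = of_real ((hnorm ip f)\<^sup>2 - (cmod (ip f g))\<^sup>2 / N)"
    unfolding complex_norm_square[symmetric] by simp
  finally have "0 \<le> (hnorm ip f)\<^sup>2 - (cmod (ip f g))\<^sup>2 / N"
    using ip_nonneg[of "f + c *\<^sub>C g"] f g by (simp add: add_mem scale_mem)
  then have "(cmod (ip f g))\<^sup>2 \<le> (hnorm ip f)\<^sup>2 * N"
    using N by (simp add: field_simps)
  then have "(cmod (ip f g))\<^sup>2 \<le> (hnorm ip f * hnorm ip g)\<^sup>2"
    by (simp add: N_def power_mult_distrib)
  then show ?thesis
    by (rule power2_le_imp_le) (use f g in \<open>simp add: hnorm_nonneg\<close>)
qed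

lemma hnorm_triangle:
  assumes f: "f \<in> H" and g: "g \<in> H"
  shows "hnorm ip (f + g) \<le> hnorm ip f + hnorm ip g"
proof (rule power2_le_imp_le)
  have "(hnorm ip (f + g))\<^sup>2 = Re (ip (f + g) (f + g))"
    using f g by (simp add: hnorm_def ip_nonneg add_mem)
  also have "\<dots> = (hnorm ip f)\<^sup>2 + 2 * Re (ip f g) + (hnorm ip g)\<^sup>2"
    using f g ip_commute[OF g f]
    by (simp add: ip_add_left ip_add_right add_mem ip_self[OF f] ip_self[OF g])
  also have "\<dots> \<le> (hnorm ip f)\<^sup>2 + 2 * (hnorm ip f * hnorm ip g) + (hnorm ip g)\<^sup>2"
    using Cauchy_Schwarz[OF f g] complex_Re_le_cmod[of "ip f g"] by simp
  finally show "(hnorm ip (f + g))\<^sup>2 \<le> (hnorm ip f + hnorm ip g)\<^sup>2"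
    by (simp add: power2_eq_square algebra_simps)
qed (use f g in \<open>simp add: hnorm_nonneg\<close>)

sublocale Metric_space H "hdist H ip"
proof
  fix f g h
  show "0 \<le> hdist H ip f g"
    by (simp add: hdist_def hnorm_nonneg diff_mem)
  have "hnorm ip (f - g) = hnorm ip (g - f)" if "f \<in> H" "g \<in> H"
  proof -
    have "f - g = (-1) *\<^sub>C (g - f)"
      by (simp add: cscale_def fun_eq_iff)
    then show ?thesis
      using that hnorm_scale[of "g - f" "-1"] by (simp add: diff_mem)
  qed
  then show "hdist H ip f g = hdist H ip g f"
    by (simp add: hdist_def)
  show "hdist H ip f g = 0 \<longleftrightarrow> f = g" if "f \<in> H" "g \<in> H"
    using that by (simp add: hdist_def hnorm_eq_0 diff_mem)
  show "hdist H ip f h \<le> hdist H ip f g + hdist H ip g h" if "f \<in> H" "g \<in> H" "h \<in> H"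
    using that hnorm_triangle[of "f - g" "g - h"] by (simp add: hdist_def diff_mem)
qed

end

locale function_hilbert_space = function_inner_space +
  assumes complete: "mcomplete"

locale rkhs = function_hilbert_space +
  fixes K :: "'a \<Rightarrow> 'a \<Rightarrow> complex"
  assumes kernel_mem: "\<And>l. l \<in> \<Omega> \<Longrightarrow> (\<lambda>z. K z l) \<in> H"
    and reproducing: "\<And>f l. \<lbrakk>f \<in> H; l \<in> \<Omega>\<rbrakk> \<Longrightarrow> f l = ip f (\<lambda>z. K z l)"

definition bounded_operator :: "('a \<Rightarrow> complex) set
    \<Rightarrow> (('a \<Rightarrow> complex) \<Rightarrow> ('a \<Rightarrow> complex) \<Rightarrow> complex)
    \<Rightarrow> (('a \<Rightarrow> complex) \<Rightarrow> 'a \<Rightarrow> complex) \<Rightarrow> bool"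
  where "bounded_operator H ip L \<longleftrightarrow>
    (\<forall>f\<in>H. L f \<in> H) \<and>
    (\<forall>f\<in>H. \<forall>g\<in>H. L (f + g) = L f + L g) \<and>
    (\<forall>c. \<forall>f\<in>H. L (c *\<^sub>C f) = c *\<^sub>C L f) \<and>
    (\<exists>M. \<forall>f\<in>H. hnorm ip (L f) \<le> M * hnorm ip f)"

text \<open>
  For a bounded operator on a Hilbert space, the vector described exists and is unique for every
  \<open>g \<in> H\<close> by the Riesz representation theorem; values for \<open>g \<notin> H\<close> are irrelevant.
\<close>
definition adjoint_op :: "('a \<Rightarrow> complex) set
    \<Rightarrow> (('a \<Rightarrow> complex) \<Rightarrow> ('a \<Rightarrow> complex) \<Rightarrow> complex)
    \<Rightarrow> (('a \<Rightarrow> complex) \<Rightarrow> 'a \<Rightarrow> complex) \<Rightarrow> ('a \<Rightarrow> complex) \<Rightarrow> 'a \<Rightarrow> complex"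
  where "adjoint_op H ip L g = (THE h. h \<in> H \<and> (\<forall>f\<in>H. ip (L f) g = ip f h))"

definition hsums :: "('a \<Rightarrow> complex) set
    \<Rightarrow> (('a \<Rightarrow> complex) \<Rightarrow> ('a \<Rightarrow> complex) \<Rightarrow> complex)
    \<Rightarrow> (nat \<Rightarrow> 'a \<Rightarrow> complex) \<Rightarrow> ('a \<Rightarrow> complex) \<Rightarrow> bool"
  where "hsums H ip s f \<longleftrightarrow>
    limitin (Metric_space.mtopology H (hdist H ip)) (\<lambda>N. \<Sum>n<N. s n) f sequentially"

definition l2 :: "(nat \<Rightarrow> complex) set"
  where "l2 = {c. summable (\<lambda>n. (cmod (c n))\<^sup>2)}"

definition l2norm :: "(nat \<Rightarrow> complex) \<Rightarrow> real"
  where "l2norm c = sqrt (\<Sum>n. (cmod (c n))\<^sup>2)"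

definition bessel_sequence :: "('a \<Rightarrow> complex) set
    \<Rightarrow> (('a \<Rightarrow> complex) \<Rightarrow> ('a \<Rightarrow> complex) \<Rightarrow> complex)
    \<Rightarrow> (nat \<Rightarrow> 'a \<Rightarrow> complex) \<Rightarrow> bool"
  where "bessel_sequence H ip f \<longleftrightarrow>
    (\<forall>n. f n \<in> H) \<and>
    (\<exists>B>0. \<forall>x\<in>H. summable (\<lambda>n. (cmod (ip x (f n)))\<^sup>2) \<and>
       (\<Sum>n. (cmod (ip x (f n)))\<^sup>2) \<le> B * (hnorm ip x)\<^sup>2)"

definition atomic_system :: "('a \<Rightarrow> complex) set
    \<Rightarrow> (('a \<Rightarrow> complex) \<Rightarrow> ('a \<Rightarrow> complex) \<Rightarrow> complex)
    \<Rightarrow> (('a \<Rightarrow> complex) \<Rightarrow> 'a \<Rightarrow> complex) \<Rightarrow> (nat \<Rightarrow> 'a \<Rightarrow> complex) \<Rightarrow> bool"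
  where "atomic_system H ip L f \<longleftrightarrow>
    (\<forall>c\<in>l2. \<exists>g. hsums H ip (\<lambda>n. c n *\<^sub>C f n) g) \<and>
    (\<exists>C>0. \<forall>x\<in>H. \<exists>a\<in>l2. l2norm a \<le> C * hnorm ip x \<and> hsums H ip (\<lambda>n. a n *\<^sub>C f n) (L x))"

definition normalized_kernel :: "(('a \<Rightarrow> complex) \<Rightarrow> ('a \<Rightarrow> complex) \<Rightarrow> complex)
    \<Rightarrow> ('a \<Rightarrow> 'a \<Rightarrow> complex) \<Rightarrow> 'a \<Rightarrow> 'a \<Rightarrow> complex"
  where "normalized_kernel ip K l = of_real (1 / hnorm ip (\<lambda>z. K z l)) *\<^sub>C (\<lambda>z. K z l)"

end

theory Submission
  imports Defs
begin

text \<open>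
  Write \<open>u n\<close> for the normalised kernel at the \<open>n\<close>-th point.  The reproducing property gives
  \<open>\<langle>f, u n\<rangle> = f(\<lambda>\<^sub>n) / \<parallel>K\<^sub>n\<parallel>\<close>, so the four statements concern a general sequence \<open>u\<close> in a Hilbert
  space and its analysis map \<open>f \<mapsto> (\<langle>f, u n\<rangle>)\<^sub>n\<close>.

  Each statement contains, openly or in disguise, that \<open>u\<close> is a Bessel sequence.  If the analysis
  map only takes values in \<open>l2\<close>, it is bounded by Baire's theorem
  (\<open>bessel_sequence_if_analysis_l2\<close>); if all series \<open>\<Sum> c n u n\<close> with \<open>c\<close> in \<open>l2\<close> converge, pairing
  them with \<open>f\<close> shows that the analysis map takes values in \<open>l2\<close>, by a classical argument of Abel
  and Dini (\<open>l2_if_all_pairings_summable\<close>).  Conversely, for a Bessel sequence all these series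
  converge (\<open>bessel_synthesis_converges\<close>).

  Given this, the atomic system yields the lower bound in (ii) by testing it at \<open>L\<^sup>* f\<close>.  The core is
  the converse \<open>bessel_expansion_if_adjoint_dominated\<close>: the lower bound says that \<open>L\<^sup>*\<close> is
  dominated by the analysis map, and, as in Douglas' factorisation theorem, \<open>L\<close> then factors through
  the synthesis map by a bounded operator from \<open>H\<close> into \<open>l2\<close>, whose coordinates are represented by
  the required Bessel sequence \<open>g\<close>.  This uses the Riesz representation theorem on subspaces
  (\<open>riesz_on_subspace\<close>), in \<open>H\<close> as well as in \<open>l2\<close>, which is itself a Hilbert space of functions.
  The expansion in (iii) gives the atomic system back with coefficients \<open>\<langle>f, g n\<rangle>\<close>, and (iii) and
  (iv) are adjoint to each other (\<open>dual_bessel_expansion\<close>).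
\<close>

section \<open>Inner products, limits and series in the function space\<close>

context function_inner_space
begin

lemma sum_mem: "(\<And>i. i \<in> I \<Longrightarrow> s i \<in> H) \<Longrightarrow> (\<Sum>i\<in>I. s i) \<in> H"
  by (rule cfun.subspace_sum[OF subspace_H])

lemma ip_zero_left: "g \<in> H \<Longrightarrow> ip 0 g = 0"
  using ip_add_left[of 0 0 g] zero_mem by simp

lemma ip_diff_left: "\<lbrakk>f \<in> H; g \<in> H; h \<in> H\<rbrakk> \<Longrightarrow> ip (f - g) h = ip f h - ip g h"
  using ip_add_left[of "f - g" g h] by (simp add: diff_mem)

lemma ip_diff_right: "\<lbrakk>f \<in> H; g \<in> H; h \<in> H\<rbrakk> \<Longrightarrow> ip h (f - g) = ip h f - ip h g"
  using ip_add_right[of "f - g" g h] by (simp add: diff_mem)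

lemma ip_sum_left:
  assumes "\<And>i. i \<in> I \<Longrightarrow> s i \<in> H" "g \<in> H"
  shows "ip (\<Sum>i\<in>I. s i) g = (\<Sum>i\<in>I. ip (s i) g)"
  using assms(1)
proof (induction I rule: infinite_finite_induct)
  case (insert i I)
  then show ?case
    using ip_add_left[of "s i" "sum s I" g] sum_mem[of I s] assms(2)
    by (simp only: sum.insert insert_iff simp_thms)
qed (auto simp: ip_zero_left assms)

lemma Re_ip_self: "f \<in> H \<Longrightarrow> Re (ip f f) = (hnorm ip f)\<^sup>2"
  by (simp add: ip_self)

lemma hnorm_minus_commute: "\<lbrakk>f \<in> H; g \<in> H\<rbrakk> \<Longrightarrow> hnorm ip (f - g) = hnorm ip (g - f)"
  using commute[of f g] by (simp add: hdist_def)

lemma eq_if_ip_right_eq: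
  assumes "f \<in> H" "g \<in> H" "\<And>h. h \<in> H \<Longrightarrow> ip h f = ip h g"
  shows "f = g"
proof -
  have "ip (f - g) (f - g) = 0"
    using assms by (simp add: ip_diff_right diff_mem)
  then show ?thesis
    using ip_definite[of "f - g"] assms by (simp add: diff_mem)
qed

lemma eq_if_ip_left_eq:
  assumes "f \<in> H" "g \<in> H" "\<And>h. h \<in> H \<Longrightarrow> ip f h = ip g h"
  shows "f = g"
  using assms eq_if_ip_right_eq ip_commute by metis

lemma limitin_iff_hnorm_tendsto:
  assumes "\<And>n. s n \<in> H"
  shows "limitin mtopology s f sequentially \<longleftrightarrow> f \<in> H \<and> (\<lambda>n. hnorm ip (s n - f)) \<longlonglongrightarrow> 0"
  using assms by (auto simp: limitin_metric_dist_null hdist_def)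

lemma hsums_iff:
  assumes "\<And>n. s n \<in> H"
  shows "hsums H ip s f \<longleftrightarrow> f \<in> H \<and> (\<lambda>N. hnorm ip ((\<Sum>n<N. s n) - f)) \<longlonglongrightarrow> 0"
  unfolding hsums_def using assms by (intro limitin_iff_hnorm_tendsto sum_mem)

lemma tendsto_ip_left:
  assumes "\<And>n. s n \<in> H" "f \<in> H" "g \<in> H" "(\<lambda>n. hnorm ip (s n - f)) \<longlonglongrightarrow> 0"
  shows "(\<lambda>n. ip (s n) g) \<longlonglongrightarrow> ip f g"
proof -
  have "(\<lambda>n. hnorm ip (s n - f) * hnorm ip g) \<longlonglongrightarrow> 0"
    using tendsto_mult_left_zero[OF assms(4)] .
  moreover have "cmod (ip (s n) g - ip f g) \<le> hnorm ip (s n - f) * hnorm ip g" for n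
    using Cauchy_Schwarz[of "s n - f" g] assms by (simp add: ip_diff_left diff_mem)
  ultimately have "(\<lambda>n. ip (s n) g - ip f g) \<longlonglongrightarrow> 0"
    by (rule Lim_null_comparison[OF always_eventually[OF allI], rotated])
  then show ?thesis by (simp add: LIM_zero_iff)
qed

lemma tendsto_hnorm:
  assumes "\<And>n. s n \<in> H" "f \<in> H" "(\<lambda>n. hnorm ip (s n - f)) \<longlonglongrightarrow> 0"
  shows "(\<lambda>n. hnorm ip (s n)) \<longlonglongrightarrow> hnorm ip f"
proof -
  have "\<bar>hnorm ip (s n) - hnorm ip f\<bar> \<le> hnorm ip (s n - f)" for n
    using hnorm_triangle[of "s n - f" f] hnorm_triangle[of "f - s n" "s n"] assms
    by (simp add: diff_mem hnorm_minus_commute[of f "s n"])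
  then have "(\<lambda>n. hnorm ip (s n) - hnorm ip f) \<longlonglongrightarrow> 0"
    by (intro Lim_null_comparison[OF always_eventually[OF allI] assms(3)]) simp
  then show ?thesis by (simp add: LIM_zero_iff)
qed

lemma hsums_ip_left:
  assumes "\<And>n. s n \<in> H" "hsums H ip s f" "g \<in> H"
  shows "(\<lambda>n. ip (s n) g) sums ip f g"
proof -
  have "(\<lambda>N. ip (\<Sum>n<N. s n) g) \<longlonglongrightarrow> ip f g"
    using assms by (intro tendsto_ip_left sum_mem) (auto simp: hsums_iff)
  then show ?thesis
    using assms by (simp add: sums_def ip_sum_left)
qed

lemma hsums_mem: "hsums H ip s f \<Longrightarrow> f \<in> H"
  unfolding hsums_def by (simp add: limitin_metric)

lemma mcompleteI:
  assumes "\<And>s. \<lbrakk>\<And>n. s n \<in> H; \<And>e. e > 0 \<Longrightarrow> \<exists>N. \<forall>m\<ge>N. \<forall>n\<ge>N. hnorm ip (s m - s n) < e\<rbrakk>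
      \<Longrightarrow> \<exists>f\<in>H. (\<lambda>n. hnorm ip (s n - f)) \<longlonglongrightarrow> 0"
  shows mcomplete
  unfolding mcomplete_def
proof (intro allI impI)
  fix s assume s: "MCauchy s"
  then have mem: "s n \<in> H" for n by (auto simp: MCauchy_def)
  have "\<exists>N. \<forall>m\<ge>N. \<forall>n\<ge>N. hnorm ip (s m - s n) < e" if "e > 0" for e
    using s that mem unfolding MCauchy_def hdist_def by simp
  then show "\<exists>f. limitin mtopology s f sequentially"
    using assms[of s] mem limitin_iff_hnorm_tendsto[of s] by blast
qed

end

lemma (in function_hilbert_space) Cauchy_imp_limit:
  assumes "\<And>n. s n \<in> H" "\<And>e. e > 0 \<Longrightarrow> \<exists>N. \<forall>m\<ge>N. \<forall>n\<ge>N. hnorm ip (s m - s n) < e"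
  obtains f where "f \<in> H" "(\<lambda>n. hnorm ip (s n - f)) \<longlonglongrightarrow> 0"
proof -
  have "MCauchy s"
    using assms unfolding MCauchy_def hdist_def by auto
  then show ?thesis
    using complete that limitin_iff_hnorm_tendsto[of s] assms(1) unfolding mcomplete_def by blast
qed

section \<open>The Riesz representation theorem and adjoints\<close>

text \<open>
  The functional \<open>\<phi>\<close> is represented by the minimiser of \<open>J s = \<parallel>s\<parallel>\<^sup>2 - 2 Re (\<phi> s)\<close>: the parallelogram
  law makes every minimising sequence Cauchy, and the first variation of \<open>J\<close> at its limit
  vanishes.  The subspace \<open>S\<close> need not be closed, so the representer lies in the closure of \<open>S\<close>;
  this is recorded as orthogonality to the orthogonal complement of \<open>S\<close>, a condition that is
  evidently linear and makes the representer unique.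
\<close>
lemma (in function_hilbert_space) riesz_on_subspace:
  assumes S: "cfun.subspace S" "S \<subseteq> H"
    and add: "\<And>s t. \<lbrakk>s \<in> S; t \<in> S\<rbrakk> \<Longrightarrow> \<phi> (s + t) = \<phi> s + \<phi> t"
    and scale: "\<And>c s. s \<in> S \<Longrightarrow> \<phi> (c *\<^sub>C s) = c * \<phi> s"
    and bound: "\<And>s. s \<in> S \<Longrightarrow> cmod (\<phi> s) \<le> C * hnorm ip s"
    and C: "C \<ge> 0"
  obtains h where "h \<in> H" "\<And>s. s \<in> S \<Longrightarrow> \<phi> s = ip s h"
    "\<And>d. \<lbrakk>d \<in> H; \<And>s. s \<in> S \<Longrightarrow> ip s d = 0\<rbrakk> \<Longrightarrow> ip h d = 0"
    "hnorm ip h \<le> C"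
proof -
  have SH: "s \<in> H" if "s \<in> S" for s using S that by blast
  define J where "J = (\<lambda>s. (hnorm ip s)\<^sup>2 - 2 * Re (\<phi> s))"
  have J_lower: "- C\<^sup>2 \<le> J s" if "s \<in> S" for s
  proof -
    have "Re (\<phi> s) \<le> C * hnorm ip s"
      using bound[OF that] complex_Re_le_cmod[of "\<phi> s"] by linarith
    moreover have "0 \<le> (hnorm ip s - C)\<^sup>2" by simp
    ultimately show ?thesis
      unfolding J_def power2_diff by (simp add: mult.commute)
  qed
  have bdd: "bdd_below (J ` S)" using J_lower by (auto intro!: bdd_belowI)
  have "0 \<in> S" using S cfun.subspace_0 by blast
  define I where "I = Inf (J ` S)"
  have I_le: "I \<le> J s" if "s \<in> S" for s
    unfolding I_def using bdd that by (intro cInf_lower) auto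
  define q where "q = (\<lambda>j. inverse (real (Suc j)))"
  have q0: "q \<longlonglongrightarrow> 0" unfolding q_def by (rule LIMSEQ_inverse_real_of_nat)
  have "\<exists>s\<in>S. J s < I + q j" for j
    using cInf_lessD[of "J ` S" "I + q j"] \<open>0 \<in> S\<close> unfolding I_def q_def by auto
  then obtain s where sS: "\<And>j. s j \<in> S" and s: "\<And>j. J (s j) < I + q j"
    by metis
  have sH: "s j \<in> H" for j using sS SH by blast
  have dist: "(hnorm ip (s m - s n))\<^sup>2 \<le> 2 * (q m + q n)" for m n
  proof -
    define t where "t = (1/2) *\<^sub>C (s m + s n)"
    have t: "t \<in> S" unfolding t_def using S sS by (simp add: cfun.subspace_add cfun.subspace_scale)
    have \<phi>t: "\<phi> t = (\<phi> (s m) + \<phi> (s n)) / 2"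
      unfolding t_def using S sS by (simp add: add scale cfun.subspace_add)
    have "4 * (hnorm ip t)\<^sup>2 = (hnorm ip (s m + s n))\<^sup>2"
      unfolding t_def using sH by (simp add: hnorm_scale add_mem power2_eq_square)
    also have "\<dots> = 2 * (hnorm ip (s m))\<^sup>2 + 2 * (hnorm ip (s n))\<^sup>2 - (hnorm ip (s m - s n))\<^sup>2"
      using sH by (simp flip: Re_ip_self add: add_mem diff_mem
        ip_add_left ip_add_right ip_diff_left ip_diff_right)
    finally have "(hnorm ip (s m - s n))\<^sup>2 = 2 * J (s m) + 2 * J (s n) - 4 * J t"
      unfolding J_def \<phi>t by (simp add: field_simps)
    also have "\<dots> \<le> 2 * (q m + q n)" using s[of m] s[of n] I_le[OF t] by (simp add: distrib_left)
    finally show ?thesis .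
  qed
  have inv_small: "\<exists>N. \<forall>n\<ge>N. q n < e" if "e > 0" for e
    using order_tendstoD(2)[OF q0 that] by (simp add: eventually_sequentially)
  have "\<exists>N. \<forall>m\<ge>N. \<forall>n\<ge>N. hnorm ip (s m - s n) < e" if "e > 0" for e
  proof -
    obtain N where N: "\<And>n. n \<ge> N \<Longrightarrow> q n < e\<^sup>2 / 4"
      using inv_small[of "e\<^sup>2 / 4"] \<open>e > 0\<close> by fastforce
    have "hnorm ip (s m - s n) < e" if "m \<ge> N" "n \<ge> N" for m n
    proof -
      note dist[of m n]
      also have "2 * (q m + q n) < e\<^sup>2" using N[OF that(1)] N[OF that(2)] by (simp add: distrib_left)
      finally show ?thesis using \<open>e > 0\<close> by (simp add: power2_less_imp_less)
    qed
    then show ?thesis by blast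
  qed
  note Cauchy = this
  obtain h where h: "h \<in> H" "(\<lambda>n. hnorm ip (s n - h)) \<longlonglongrightarrow> 0"
    using Cauchy_imp_limit[OF sH Cauchy] by blast
  have rep: "\<phi> t = ip t h" if t: "t \<in> S" for t
  proof -
    have tH: "t \<in> H" using t SH by blast
    have var: "0 \<le> 2 * Re (c * (ip t h - \<phi> t)) + (cmod c)\<^sup>2 * (hnorm ip t)\<^sup>2" for c
    proof -
      have "- q j \<le>
          2 * Re (cnj c * ip (s j) t) - 2 * Re (c * \<phi> t) + (cmod c)\<^sup>2 * (hnorm ip t)\<^sup>2" for j
      proof -
        have mem: "s j + c *\<^sub>C t \<in> S"
          using S sS t by (simp add: cfun.subspace_add cfun.subspace_scale)
        have "ip (s j + c *\<^sub>C t) (s j + c *\<^sub>C t)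
            = ip (s j) (s j) + cnj c * ip (s j) t + c * ip t (s j) + (c * cnj c) * ip t t"
          using sH tH by (simp add: add_mem scale_mem ip_add_left ip_add_right
              ip_scale_left ip_scale_right algebra_simps)
        then have "Re (ip (s j + c *\<^sub>C t) (s j + c *\<^sub>C t)) = Re (ip (s j) (s j))
            + Re (cnj c * ip (s j) t) + Re (c * ip t (s j)) + Re ((c * cnj c) * ip t t)"
          by (simp only: plus_complex.simps)
        moreover have "Re (c * ip t (s j)) = Re (cnj c * ip (s j) t)"
          using ip_commute[OF tH sH[of j]] by simp
        moreover have "(c * cnj c) * ip t t = of_real ((cmod c)\<^sup>2 * (hnorm ip t)\<^sup>2)"
          by (simp add: ip_self[OF tH] complex_norm_square[symmetric] flip: of_real_power)
        ultimately have "(hnorm ip (s j + c *\<^sub>C t))\<^sup>2 = (hnorm ip (s j))\<^sup>2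
            + 2 * Re (cnj c * ip (s j) t) + (cmod c)\<^sup>2 * (hnorm ip t)\<^sup>2"
          using Re_ip_self[OF SH[OF mem]] Re_ip_self[OF sH[of j]]
          by (simp only: Re_complex_of_real mult_2 add.assoc)
        moreover have "\<phi> (s j + c *\<^sub>C t) = \<phi> (s j) + c * \<phi> t"
          using S sS t by (simp add: add scale cfun.subspace_scale)
        ultimately show ?thesis
          using I_le[OF mem] s[of j] unfolding J_def by simp
      qed
      moreover have "(\<lambda>j. - q j) \<longlonglongrightarrow> - 0"
        by (intro tendsto_minus q0)
      moreover have "(\<lambda>j. 2 * Re (cnj c * ip (s j) t) - 2 * Re (c * \<phi> t) + (cmod c)\<^sup>2 * (hnorm ip t)\<^sup>2)
          \<longlonglongrightarrow> 2 * Re (cnj c * ip h t) - 2 * Re (c * \<phi> t) + (cmod c)\<^sup>2 * (hnorm ip t)\<^sup>2"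
        by (intro tendsto_intros tendsto_ip_left sH h tH)
      ultimately have "- 0 \<le> 2 * Re (cnj c * ip h t) - 2 * Re (c * \<phi> t) + (cmod c)\<^sup>2 * (hnorm ip t)\<^sup>2"
        by (intro LIMSEQ_le) auto
      moreover have "Re (cnj c * ip h t) = Re (c * ip t h)"
        using ip_commute[OF h(1) tH] by simp
      ultimately show ?thesis by (simp add: algebra_simps)
    qed
    define w where "w = ip t h - \<phi> t"
    define r where "r = 1 / (1 + (hnorm ip t)\<^sup>2)"
    have r: "r > 0" "r * (hnorm ip t)\<^sup>2 < 1"
      unfolding r_def by (auto simp: add_pos_nonneg field_simps)
    have "- of_real r * cnj w * w = of_real (- r * (cmod w)\<^sup>2)"
      unfolding of_real_mult complex_norm_square by simp
    then have "Re (- of_real r * cnj w * w) = - r * (cmod w)\<^sup>2"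
      by (simp only: Re_complex_of_real)
    moreover have "(cmod (- of_real r * cnj w))\<^sup>2 = r * r * (cmod w)\<^sup>2"
      by (simp add: norm_mult power2_eq_square)
    \<comment> \<open>the step \<open>-r cnj w\<close> decreases \<open>J\<close> to first order unless \<open>w = 0\<close>\<close>
    ultimately have "0 \<le> r * (cmod w)\<^sup>2 * (r * (hnorm ip t)\<^sup>2 - 2)"
      using var[of "- of_real r * cnj w", folded w_def] by (simp add: algebra_simps)
    then have "(cmod w)\<^sup>2 \<le> 0"
      using r by (smt (verit) mult_pos_neg mult_pos_pos zero_le_power2)
    then show ?thesis by (simp add: w_def)
  qed
  have perp: "ip h d = 0" if "d \<in> H" "\<And>s. s \<in> S \<Longrightarrow> ip s d = 0" for d
  proof -
    have "(\<lambda>j. ip (s j) d) \<longlonglongrightarrow> ip h d"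
      by (intro tendsto_ip_left sH h that)
    then show ?thesis using that(2)[OF sS] by (simp add: LIMSEQ_const_iff)
  qed
  have "cmod (ip (s j) h) \<le> C * hnorm ip (s j)" for j
    using bound[OF sS] rep[OF sS] by simp
  then have "cmod (ip h h) \<le> C * hnorm ip h"
    by (intro LIMSEQ_le[OF tendsto_norm[OF tendsto_ip_left[OF sH h(1,1,2)]]
        tendsto_mult_left[OF tendsto_hnorm[OF sH h]]]) auto
  then have "hnorm ip h * hnorm ip h \<le> C * hnorm ip h"
    using h(1) by (simp add: ip_self power2_eq_square norm_mult hnorm_nonneg)
  then have "hnorm ip h \<le> C"
    using C hnorm_nonneg[OF h(1)] by (cases "hnorm ip h = 0") auto
  then show thesis using that h(1) rep perp by blast
qed

lemma (in function_hilbert_space) adjoint_op_mem_and_ip: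
  assumes L: "bounded_operator H ip L" and g: "g \<in> H"
  shows "adjoint_op H ip L g \<in> H \<and> (\<forall>f\<in>H. ip (L f) g = ip f (adjoint_op H ip L g))"
  unfolding adjoint_op_def
proof (rule theI'[where P = "\<lambda>h. h \<in> H \<and> (\<forall>f\<in>H. ip (L f) g = ip f h)"])
  obtain M where M: "\<And>f. f \<in> H \<Longrightarrow> hnorm ip (L f) \<le> M * hnorm ip f"
    and mem: "\<And>f. f \<in> H \<Longrightarrow> L f \<in> H"
    using L unfolding bounded_operator_def by blast
  have "cmod (ip (L f) g) \<le> (\<bar>M\<bar> * hnorm ip g) * hnorm ip f" if f: "f \<in> H" for f
  proof -
    have "hnorm ip (L f) \<le> \<bar>M\<bar> * hnorm ip f"
      using M[OF f] hnorm_nonneg[OF f] mult_right_mono[OF abs_ge_self, of "hnorm ip f" M] by linarith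
    then show ?thesis
      using Cauchy_Schwarz[OF mem[OF f] g] hnorm_nonneg[OF g]
        mult_right_mono[of "hnorm ip (L f)" "\<bar>M\<bar> * hnorm ip f" "hnorm ip g"]
      by (simp add: mult_ac)
  qed
  note bound = this
  have add: "ip (L (s + t)) g = ip (L s) g + ip (L t) g" if "s \<in> H" "t \<in> H" for s t
    using L g that by (simp add: bounded_operator_def ip_add_left)
  have scale: "ip (L (c *\<^sub>C s)) g = c * ip (L s) g" if "s \<in> H" for c s
    using L g that by (simp add: bounded_operator_def ip_scale_left)
  have "0 \<le> \<bar>M\<bar> * hnorm ip g" using g by (simp add: hnorm_nonneg)
  then obtain h where "h \<in> H" "\<And>f. f \<in> H \<Longrightarrow> ip (L f) g = ip f h"
    using riesz_on_subspace[where \<phi> = "\<lambda>f. ip (L f) g", OF subspace_H subset_refl add scale bound]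
    by metis
  then show "\<exists>!h. h \<in> H \<and> (\<forall>f\<in>H. ip (L f) g = ip f h)"
    by (metis eq_if_ip_right_eq)
qed

section \<open>The Hilbert space of square-summable sequences\<close>

definition l2ip :: "(nat \<Rightarrow> complex) \<Rightarrow> (nat \<Rightarrow> complex) \<Rightarrow> complex"
  where "l2ip a b = (\<Sum>n. a n * cnj (b n))"

lemma l2_iff: "a \<in> l2 \<longleftrightarrow> summable (\<lambda>n. (cmod (a n))\<^sup>2)"
  by (simp add: l2_def)

lemma summable_l2ip:
  assumes "a \<in> l2" "b \<in> l2"
  shows "summable (\<lambda>n. a n * cnj (b n))"
proof (rule summable_comparison_test')
  show "summable (\<lambda>n. (cmod (a n))\<^sup>2 + (cmod (b n))\<^sup>2)"
    using assms by (intro summable_add) (auto simp: l2_iff)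
  show "norm (a n * cnj (b n)) \<le> (cmod (a n))\<^sup>2 + (cmod (b n))\<^sup>2" for n
  proof -
    have "2 * (cmod (a n) * cmod (b n)) \<le> (cmod (a n))\<^sup>2 + (cmod (b n))\<^sup>2"
      using sum_squares_bound[of "cmod (a n)" "cmod (b n)"] by (simp add: mult_ac)
    moreover have "0 \<le> cmod (a n) * cmod (b n)" by simp
    ultimately show ?thesis by (simp only: norm_mult complex_mod_cnj)
  qed
qed

lemma l2_add:
  assumes "a \<in> l2" "b \<in> l2"
  shows "a + b \<in> l2"
  unfolding l2_iff
proof (rule summable_comparison_test')
  show "summable (\<lambda>n. 2 * (cmod (a n))\<^sup>2 + 2 * (cmod (b n))\<^sup>2)"
    using assms by (intro summable_add summable_mult) (auto simp: l2_iff)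
  show "norm ((cmod ((a + b) n))\<^sup>2) \<le> 2 * (cmod (a n))\<^sup>2 + 2 * (cmod (b n))\<^sup>2" for n
  proof -
    have "(cmod (a n + b n))\<^sup>2 \<le> (cmod (a n) + cmod (b n))\<^sup>2"
      by (intro power_mono norm_triangle_ineq) simp
    also have "\<dots> \<le> 2 * (cmod (a n))\<^sup>2 + 2 * (cmod (b n))\<^sup>2"
      using sum_squares_bound[of "cmod (a n)" "cmod (b n)"] by (simp add: power2_sum)
    finally show ?thesis by simp
  qed
qed

lemma l2_scale: "a \<in> l2 \<Longrightarrow> c *\<^sub>C a \<in> l2"
  by (auto simp: l2_iff cscale_def norm_mult power_mult_distrib intro: summable_mult)

lemma l2ip_self: "a \<in> l2 \<Longrightarrow> l2ip a a = of_real (\<Sum>n. (cmod (a n))\<^sup>2)"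
  unfolding l2ip_def by (subst suminf_of_real) (simp_all only: l2_iff complex_norm_square)

interpretation l2: function_inner_space UNIV l2 l2ip
proof
  have "0 \<in> l2" by (simp add: l2_iff)
  then show "cfun.subspace l2"
    unfolding cfun.subspace_def using l2_add l2_scale by blast
next
  fix f g h :: "nat \<Rightarrow> complex" assume "f \<in> l2" "g \<in> l2" "h \<in> l2"
  then show "l2ip (f + g) h = l2ip f h + l2ip g h"
    unfolding l2ip_def by (simp add: suminf_add[OF summable_l2ip summable_l2ip] distrib_right)
next
  fix c and f g :: "nat \<Rightarrow> complex" assume "f \<in> l2" "g \<in> l2"
  then show "l2ip (c *\<^sub>C f) g = c * l2ip f g"
    unfolding l2ip_def cscale_def by (simp add: suminf_mult[OF summable_l2ip] mult.assoc)
next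
  fix f g :: "nat \<Rightarrow> complex" assume "f \<in> l2" "g \<in> l2"
  then have "(\<lambda>n. cnj (g n * cnj (f n))) sums cnj (l2ip g f)"
    unfolding l2ip_def sums_cnj by (intro summable_sums summable_l2ip)
  then show "l2ip f g = cnj (l2ip g f)"
    unfolding l2ip_def[of f g] by (simp add: sums_iff mult.commute)
next
  fix f :: "nat \<Rightarrow> complex" assume f: "f \<in> l2"
  then show "0 \<le> Re (l2ip f f)"
    by (simp add: l2ip_self l2_iff suminf_nonneg)
  assume "l2ip f f = 0"
  then have "(cmod (f n))\<^sup>2 = 0" for n
    using f suminf_eq_zero_iff[of "\<lambda>n. (cmod (f n))\<^sup>2"] by (simp add: l2ip_self l2_iff)
  then show "f = 0" by (simp add: fun_eq_iff)
qed simp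

lemma l2_hnorm_square: "a \<in> l2 \<Longrightarrow> (hnorm l2ip a)\<^sup>2 = (\<Sum>n. (cmod (a n))\<^sup>2)"
  using l2.Re_ip_self[of a] by (simp add: l2ip_self)

lemma l2norm_eq_hnorm: "a \<in> l2 \<Longrightarrow> l2norm a = hnorm l2ip a"
  by (simp add: l2norm_def hnorm_def l2ip_self)

lemma l2_finite_sum_le:
  assumes "a \<in> l2" "finite F"
  shows "(\<Sum>n\<in>F. (cmod (a n))\<^sup>2) \<le> (hnorm l2ip a)\<^sup>2"
  using assms unfolding l2_hnorm_square[OF assms(1)]
  by (intro sum_le_suminf) (auto simp: l2_iff)

lemma l2_coordinate_le:
  assumes "a \<in> l2"
  shows "cmod (a n) \<le> hnorm l2ip a"
proof -
  have "(cmod (a n))\<^sup>2 \<le> (hnorm l2ip a)\<^sup>2"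
    using l2_finite_sum_le[OF assms, of "{n}"] by simp
  then show ?thesis
    using l2.hnorm_nonneg[OF assms] by (rule power2_le_imp_le)
qed

lemma l2I_partial_sums:
  assumes "\<And>N. (\<Sum>n<N. (cmod (a n))\<^sup>2) \<le> e\<^sup>2" "e \<ge> 0"
  shows "a \<in> l2" "hnorm l2ip a \<le> e"
proof -
  have sm: "summable (\<lambda>n. (cmod (a n))\<^sup>2)"
    by (rule summableI_nonneg_bounded[of _ "e\<^sup>2"]) (use assms in auto)
  then show a: "a \<in> l2" by (simp add: l2_iff)
  have "(hnorm l2ip a)\<^sup>2 \<le> e\<^sup>2"
    unfolding l2_hnorm_square[OF a] by (intro suminf_le_const[OF sm] assms)
  then show "hnorm l2ip a \<le> e" using assms(2) by (rule power2_le_imp_le)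
qed

text \<open>
  Completeness: a Cauchy sequence converges coordinatewise, and the Cauchy estimate passes to the
  coordinatewise limit through each finite partial sum.
\<close>
interpretation l2: function_hilbert_space UNIV l2 l2ip
proof (unfold_locales, rule l2.mcompleteI)
  fix s :: "nat \<Rightarrow> nat \<Rightarrow> complex"
  assume s: "\<And>j. s j \<in> l2"
    and C: "\<And>e. e > 0 \<Longrightarrow> \<exists>N. \<forall>m\<ge>N. \<forall>n\<ge>N. hnorm l2ip (s m - s n) < e"
  have "Cauchy (\<lambda>j. s j i)" for i
    unfolding Cauchy_iff
  proof (intro allI impI)
    fix e :: real assume "e > 0"
    then obtain N where N: "\<forall>m\<ge>N. \<forall>n\<ge>N. hnorm l2ip (s m - s n) < e" using C by blast
    have "cmod (s m i - s n i) < e" if "m \<ge> N" "n \<ge> N" for m n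
      using l2_coordinate_le[OF l2.diff_mem[OF s s], of m n i] N that by (auto simp: order.strict_trans1)
    then show "\<exists>N. \<forall>m\<ge>N. \<forall>n\<ge>N. norm (s m i - s n i) < e" by blast
  qed
  then have "\<exists>l. (\<lambda>j. s j i) \<longlonglongrightarrow> l" for i
    using Cauchy_convergent convergent_def by blast
  then obtain f where f: "\<And>i. (\<lambda>j. s j i) \<longlonglongrightarrow> f i" by metis
  have tail: "\<exists>N. \<forall>m\<ge>N. s m - f \<in> l2 \<and> hnorm l2ip (s m - f) \<le> e" if "e > 0" for e
  proof -
    obtain N where N: "\<forall>m\<ge>N. \<forall>n\<ge>N. hnorm l2ip (s m - s n) < e" using C \<open>e > 0\<close> by blast
    have "s m - f \<in> l2 \<and> hnorm l2ip (s m - f) \<le> e" if m: "m \<ge> N" for m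
    proof -
      have "(\<Sum>i<M. (cmod ((s m - f) i))\<^sup>2) \<le> e\<^sup>2" for M
      proof (rule LIMSEQ_le_const2)
        show "(\<lambda>n. \<Sum>i<M. (cmod (s m i - s n i))\<^sup>2) \<longlonglongrightarrow> (\<Sum>i<M. (cmod ((s m - f) i))\<^sup>2)"
          unfolding fun_diff_def by (intro tendsto_intros f)
        have "(\<Sum>i<M. (cmod (s m i - s n i))\<^sup>2) \<le> e\<^sup>2" if "n \<ge> N" for n
        proof -
          have "(\<Sum>i<M. (cmod ((s m - s n) i))\<^sup>2) \<le> (hnorm l2ip (s m - s n))\<^sup>2"
            by (intro l2_finite_sum_le l2.diff_mem s finite_lessThan)
          also have "\<dots> \<le> e\<^sup>2"
            using N m that by (intro power_mono l2.hnorm_nonneg l2.diff_mem s) (auto simp: less_imp_le)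
          finally show ?thesis by simp
        qed
        then show "\<exists>N. \<forall>n\<ge>N. (\<Sum>i<M. (cmod (s m i - s n i))\<^sup>2) \<le> e\<^sup>2" by blast
      qed
      then show ?thesis using l2I_partial_sums[of "s m - f" e] \<open>e > 0\<close> by simp
    qed
    then show ?thesis by blast
  qed
  obtain N where "s N - f \<in> l2" using tail[of 1] by auto
  then have "s N - (s N - f) \<in> l2" using s l2.diff_mem by blast
  then have fl2: "f \<in> l2" by simp
  have "(\<lambda>n. hnorm l2ip (s n - f)) \<longlonglongrightarrow> 0"
  proof (rule LIMSEQ_I)
    fix e :: real assume "e > 0"
    then obtain N where "\<forall>m\<ge>N. hnorm l2ip (s m - f) \<le> e / 2" using tail[of "e/2"] by auto
    then show "\<exists>N. \<forall>n\<ge>N. norm (hnorm l2ip (s n - f) - 0) < e"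
      using \<open>e > 0\<close> l2.hnorm_nonneg[OF l2.diff_mem[OF s fl2]]
      by (intro exI[of _ N]) (auto simp: field_simps intro: le_less_trans)
  qed
  then show "\<exists>f\<in>l2. (\<lambda>n. hnorm l2ip (s n - f)) \<longlonglongrightarrow> 0" using fl2 by blast
qed

text \<open>
  Contrapositive after Abel and Dini: if the partial sums \<open>T\<close> of \<open>1 + \<Sum>\<bar>a n\<bar>\<^sup>2\<close> are unbounded, then
  \<open>c n = cnj (a n) / T (n + 1)\<close> is square-summable, because \<open>\<bar>c n\<bar>\<^sup>2 \<le> 1 / T n - 1 / T (n + 1)\<close>
  telescopes, whereas \<open>\<Sum> c n * a n\<close> has blocks of size at least \<open>1/2\<close> arbitrarily far out.
\<close>
lemma l2_if_all_pairings_summable: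
  assumes "\<And>c. c \<in> l2 \<Longrightarrow> summable (\<lambda>n. c n * a n)"
  shows "a \<in> l2"
proof (rule ccontr)
  assume na: "a \<notin> l2"
  define T where "T = (\<lambda>n. 1 + (\<Sum>k<n. (cmod (a k))\<^sup>2))"
  have T1: "T n \<ge> 1" for n unfolding T_def by (simp add: sum_nonneg)
  then have T0: "T n > 0" for n using less_le_trans[OF zero_less_one] by blast
  have TS: "T (Suc n) = T n + (cmod (a n))\<^sup>2" for n unfolding T_def by simp
  have Tmono: "T m \<le> T n" if "m \<le> n" for m n
    using that by (rule lift_Suc_mono_le[rotated]) (simp add: TS)
  have unbounded: "\<exists>n. T n > x" for x
  proof (rule ccontr)
    assume "\<not> (\<exists>n. T n > x)"
    then have le: "T n \<le> x" for n by (meson not_less)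
    have "(\<Sum>k<n. (cmod (a k))\<^sup>2) \<le> x" for n using le[of n] unfolding T_def by simp
    then have "summable (\<lambda>k. (cmod (a k))\<^sup>2)" by (intro summableI_nonneg_bounded) auto
    then show False using na by (simp add: l2_iff)
  qed
  define c where "c = (\<lambda>n. cnj (a n) / of_real (T (Suc n)))"
  have sq: "(cmod (c n))\<^sup>2 \<le> 1 / T n - 1 / T (Suc n)" for n
  proof -
    have "(cmod (c n))\<^sup>2 = (cmod (a n))\<^sup>2 / (T (Suc n) * T (Suc n))"
      unfolding c_def using T0[of "Suc n"] by (simp add: norm_divide power_divide power2_eq_square)
    also have "\<dots> \<le> (cmod (a n))\<^sup>2 / (T n * T (Suc n))"
      using T0[of n] T0[of "Suc n"] Tmono[of n "Suc n"]
      by (intro divide_left_mono mult_right_mono mult_pos_pos) auto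
    also have "\<dots> = 1 / T n - 1 / T (Suc n)"
      using T0[of n] T0[of "Suc n"] TS[of n] by (simp add: field_simps)
    finally show ?thesis .
  qed
  have "(\<Sum>n<N. (cmod (c n))\<^sup>2) \<le> 1\<^sup>2" for N
  proof -
    have "(\<Sum>n<N. (cmod (c n))\<^sup>2) \<le> (\<Sum>n<N. 1 / T n - 1 / T (Suc n))"
      by (intro sum_mono sq)
    also have "\<dots> = 1 / T 0 - 1 / T N" by (rule sum_lessThan_telescope')
    also have "\<dots> \<le> 1\<^sup>2" using T0[of N] by (simp add: T_def)
    finally show ?thesis .
  qed
  then have "c \<in> l2" using l2I_partial_sums[of c 1] by simp
  then have "summable (\<lambda>n. c n * a n)" by (rule assms)
  then obtain M where M: "\<And>m n. m \<ge> M \<Longrightarrow> cmod (\<Sum>k=m..<n. c k * a k) < 1/2"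
    unfolding summable_Cauchy by (metis zero_less_divide_1_iff zero_less_numeral)
  obtain N where N: "T N > 2 * T M" using unbounded by blast
  then have "M < N" using Tmono[of N M] T0[of M] by (cases "M < N") auto
  have "(\<Sum>k=M..<N. c k * a k) = of_real (\<Sum>k=M..<N. (cmod (a k))\<^sup>2 / T (Suc k))"
    unfolding of_real_sum of_real_divide complex_norm_square c_def by (simp add: mult.commute)
  then have "(\<Sum>k=M..<N. (cmod (a k))\<^sup>2 / T (Suc k)) < 1/2"
    using M[of M N] by (smt (verit) order_refl norm_of_real)
  moreover have "(\<Sum>k=M..<N. (cmod (a k))\<^sup>2 / T N) \<le> (\<Sum>k=M..<N. (cmod (a k))\<^sup>2 / T (Suc k))"
    using T0 Tmono by (intro sum_mono divide_left_mono mult_pos_pos) auto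
  moreover have "(\<Sum>k=M..<N. (cmod (a k))\<^sup>2 / T N) = (T N - T M) / T N"
  proof -
    have "(\<Sum>k=M..<N. (cmod (a k))\<^sup>2) = (\<Sum>k=M..<N. T (Suc k) - T k)" by (simp add: TS)
    also have "\<dots> = T N - T M" using \<open>M < N\<close> by (simp add: sum_Suc_diff')
    finally show ?thesis by (simp flip: sum_divide_distrib)
  qed
  ultimately have "(T N - T M) / T N < 1/2" by linarith
  then show False using N T0[of N] by (simp add: field_simps)
qed

section \<open>Bessel sequences\<close>

definition analysis :: "(('a \<Rightarrow> complex) \<Rightarrow> ('a \<Rightarrow> complex) \<Rightarrow> complex)
    \<Rightarrow> (nat \<Rightarrow> 'a \<Rightarrow> complex) \<Rightarrow> ('a \<Rightarrow> complex) \<Rightarrow> nat \<Rightarrow> complex"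
  where "analysis ip u f = (\<lambda>n. ip f (u n))"

context function_inner_space
begin

lemma analysis_add:
  assumes "\<And>n. u n \<in> H" "f \<in> H" "g \<in> H"
  shows "analysis ip u (f + g) = analysis ip u f + analysis ip u g"
  using assms by (simp add: analysis_def fun_eq_iff ip_add_left)

lemma analysis_scale:
  assumes "\<And>n. u n \<in> H" "f \<in> H"
  shows "analysis ip u (c *\<^sub>C f) = c *\<^sub>C analysis ip u f"
  using assms unfolding analysis_def by (simp add: ip_scale_left) (simp add: cscale_def)

lemma analysis_diff:
  assumes "\<And>n. u n \<in> H" "f \<in> H" "g \<in> H"
  shows "analysis ip u (f - g) = analysis ip u f - analysis ip u g"
  using assms by (simp add: analysis_def fun_eq_iff ip_diff_left)

lemma bessel_sequence_iff_analysis_bounded: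
  "bessel_sequence H ip u \<longleftrightarrow> (\<forall>n. u n \<in> H) \<and> (\<exists>B>0. \<forall>x\<in>H. analysis ip u x \<in> l2 \<and>
      (hnorm l2ip (analysis ip u x))\<^sup>2 \<le> B * (hnorm ip x)\<^sup>2)"
  unfolding bessel_sequence_def
  by (intro conj_cong refl ex_cong1 ball_cong)
    (auto simp: analysis_def l2_hnorm_square l2_iff)

lemma ip_synthesis:
  assumes "\<And>n. u n \<in> H" "hsums H ip (\<lambda>n. c n *\<^sub>C u n) y" "f \<in> H"
  shows "(\<lambda>n. c n * cnj (ip f (u n))) sums ip y f" and "ip y f = l2ip c (analysis ip u f)"
proof -
  have "(\<lambda>n. ip (c n *\<^sub>C u n) f) sums ip y f"
    using assms by (intro hsums_ip_left) (auto simp: scale_mem)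
  moreover have "ip (c n *\<^sub>C u n) f = c n * cnj (ip f (u n))" for n
    using assms ip_commute[of "u n" f] by (simp add: ip_scale_left)
  ultimately show "(\<lambda>n. c n * cnj (ip f (u n))) sums ip y f" by simp
  then show "ip y f = l2ip c (analysis ip u f)"
    unfolding l2ip_def analysis_def by (simp add: sums_iff)
qed

text \<open>
  The norm of a finite combination \<open>x\<close> is estimated by \<open>\<parallel>x\<parallel>\<^sup>2 = \<Sum> c i \<langle>u i, x\<rangle>\<close>, the Cauchy-Schwarz
  inequality for finite sums, and the Bessel bound at \<open>x\<close> itself.
\<close>
lemma hnorm_bessel_combination_le:
  assumes u: "\<And>n. u n \<in> H" and B: "B > 0"
    and bessel: "\<And>x. x \<in> H \<Longrightarrow> analysis ip u x \<in> l2 \<and>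
      (hnorm l2ip (analysis ip u x))\<^sup>2 \<le> B * (hnorm ip x)\<^sup>2"
    and F: "finite F"
  shows "(hnorm ip (\<Sum>i\<in>F. c i *\<^sub>C u i))\<^sup>2 \<le> B * (\<Sum>i\<in>F. (cmod (c i))\<^sup>2)"
proof -
  define x where "x = (\<Sum>i\<in>F. c i *\<^sub>C u i)"
  have x: "x \<in> H" unfolding x_def by (intro sum_mem scale_mem u)
  have nx: "hnorm ip x \<ge> 0" using x by (rule hnorm_nonneg)
  have "(\<Sum>i\<in>F. (cmod (ip x (u i)))\<^sup>2) \<le> (hnorm l2ip (analysis ip u x))\<^sup>2"
    using l2_finite_sum_le[OF _ F, of "analysis ip u x"] bessel[OF x] by (simp add: analysis_def)
  then have "(\<Sum>i\<in>F. (cmod (ip x (u i)))\<^sup>2) \<le> B * (hnorm ip x)\<^sup>2"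
    using bessel[OF x] by linarith
  then have L2: "L2_set (\<lambda>i. cmod (ip x (u i))) F \<le> sqrt B * hnorm ip x"
    using nx unfolding L2_set_def by (metis real_sqrt_le_mono real_sqrt_mult real_sqrt_unique)
  have "ip x x = (\<Sum>i\<in>F. c i * ip (u i) x)"
    using u x by (subst x_def) (simp add: ip_sum_left scale_mem ip_scale_left)
  moreover have "cmod (ip x x) = (hnorm ip x)\<^sup>2"
    using x nx by (simp add: ip_self norm_power)
  ultimately have "(hnorm ip x)\<^sup>2 \<le> (\<Sum>i\<in>F. cmod (c i * ip (u i) x))"
    by (metis norm_sum)
  also have "\<dots> = (\<Sum>i\<in>F. \<bar>cmod (c i)\<bar> * \<bar>cmod (ip x (u i))\<bar>)"
    using u x by (intro sum.cong refl) (metis abs_norm_cancel complex_mod_cnj ip_commute norm_mult)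
  also have "\<dots> \<le> L2_set (\<lambda>i. cmod (c i)) F * L2_set (\<lambda>i. cmod (ip x (u i))) F"
    by (rule L2_set_mult_ineq)
  also have "\<dots> \<le> L2_set (\<lambda>i. cmod (c i)) F * (sqrt B * hnorm ip x)"
    by (intro mult_left_mono L2 L2_set_nonneg)
  finally have "hnorm ip x * hnorm ip x \<le> (L2_set (\<lambda>i. cmod (c i)) F * sqrt B) * hnorm ip x"
    by (simp add: power2_eq_square mult_ac)
  then have "hnorm ip x \<le> L2_set (\<lambda>i. cmod (c i)) F * sqrt B"
    using nx B by (cases "hnorm ip x = 0") (auto simp: L2_set_nonneg)
  then have "(hnorm ip x)\<^sup>2 \<le> (L2_set (\<lambda>i. cmod (c i)) F * sqrt B)\<^sup>2"
    using nx by (intro power_mono)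
  also have "\<dots> = B * (\<Sum>i\<in>F. (cmod (c i))\<^sup>2)"
    using B by (simp add: power_mult_distrib L2_set_def sum_nonneg)
  finally show ?thesis unfolding x_def .
qed

end

lemma (in function_hilbert_space) bessel_synthesis_converges:
  assumes "bessel_sequence H ip u" "c \<in> l2"
  obtains y where "hsums H ip (\<lambda>n. c n *\<^sub>C u n) y"
proof -
  from assms obtain B where u: "\<And>n. u n \<in> H" and B: "B > 0"
    and bessel: "\<And>x. x \<in> H \<Longrightarrow> analysis ip u x \<in> l2 \<and>
      (hnorm l2ip (analysis ip u x))\<^sup>2 \<le> B * (hnorm ip x)\<^sup>2"
    unfolding bessel_sequence_iff_analysis_bounded by blast
  let ?S = "\<lambda>N. \<Sum>n<N. c n *\<^sub>C u n"
  have mem: "?S N \<in> H" for N by (intro sum_mem scale_mem u)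
  have Cauchy: "\<exists>N. \<forall>m\<ge>N. \<forall>n\<ge>N. hnorm ip (?S m - ?S n) < e" if "e > 0" for e
  proof -
    have "e\<^sup>2 / B > 0" using that B by simp
    moreover have "summable (\<lambda>n. (cmod (c n))\<^sup>2)" using assms(2) by (simp add: l2_iff)
    ultimately obtain N
      where N: "\<And>m n. m \<ge> N \<Longrightarrow> norm (\<Sum>k=m..<n. (cmod (c k))\<^sup>2) < e\<^sup>2 / B"
      unfolding summable_Cauchy by blast
    have ordered: "hnorm ip (?S n - ?S m) < e" if "m \<ge> N" "m \<le> n" for m n
    proof -
      have "?S n - ?S m = (\<Sum>k=m..<n. c k *\<^sub>C u k)"
        using that(2) by (simp add: sum_diff_nat_ivl lessThan_atLeast0)
      then have "(hnorm ip (?S n - ?S m))\<^sup>2 \<le> B * (\<Sum>k=m..<n. (cmod (c k))\<^sup>2)"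
        using hnorm_bessel_combination_le[OF u B bessel, of "{m..<n}" c] by simp
      also have "\<dots> < e\<^sup>2"
        using N[OF that(1), of n] B by (simp add: sum_nonneg field_simps)
      finally show ?thesis using \<open>e > 0\<close> by (simp add: power2_less_imp_less)
    qed
    have "hnorm ip (?S m - ?S n) < e" if "m \<ge> N" "n \<ge> N" for m n
      using ordered[of m n] ordered[of n m] that hnorm_minus_commute[OF mem mem, of m n]
      by (cases "m \<le> n") auto
    then show ?thesis by blast
  qed
  obtain y where "y \<in> H" "(\<lambda>N. hnorm ip (?S N - y)) \<longlonglongrightarrow> 0"
    using Cauchy_imp_limit[OF mem Cauchy] by blast
  then have "hsums H ip (\<lambda>n. c n *\<^sub>C u n) y"
    using hsums_iff[of "\<lambda>n. c n *\<^sub>C u n" y] u by (simp add: scale_mem)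
  then show thesis by (rule that)
qed

text \<open>
  Uniform boundedness: the closed sets on which the partial sums stay below an integer \<open>m\<close> cover
  \<open>H\<close>, so by Baire one of them contains a ball, and a bound on a ball gives a bound on \<open>H\<close> by
  translation and scaling.
\<close>
lemma (in function_hilbert_space) bessel_sequence_if_analysis_l2:
  assumes u: "\<And>n. u n \<in> H" and l2: "\<And>f. f \<in> H \<Longrightarrow> analysis ip u f \<in> l2"
  shows "bessel_sequence H ip u"
proof -
  let ?P = "\<lambda>f N. \<Sum>n<N. (cmod (ip f (u n)))\<^sup>2"
  define E where "E = (\<lambda>m::nat. {f\<in>H. \<forall>N. ?P f N \<le> real m})"
  have closed: "closedin mtopology (E m)" for m
    unfolding metric_closedin_iff_sequentially_closed
  proof (intro conjI allI impI)
    show "E m \<subseteq> H" unfolding E_def by blast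
    fix s f assume asm: "range s \<subseteq> E m \<and> limitin mtopology s f sequentially"
    then have s: "s j \<in> H" "?P (s j) N \<le> real m" for j N unfolding E_def by auto
    have f: "f \<in> H" "(\<lambda>n. hnorm ip (s n - f)) \<longlonglongrightarrow> 0"
      using asm limitin_iff_hnorm_tendsto[OF s(1)] by auto
    have "?P f N \<le> real m" for N
    proof (rule LIMSEQ_le_const2)
      show "(\<lambda>j. ?P (s j) N) \<longlonglongrightarrow> ?P f N"
        by (intro tendsto_intros tendsto_ip_left s(1) f u)
    qed (use s(2) in blast)
    then show "f \<in> E m" unfolding E_def using f(1) by blast
  qed
  have "f \<in> \<Union> (range E)" if f: "f \<in> H" for f
  proof -
    obtain m where "(hnorm l2ip (analysis ip u f))\<^sup>2 \<le> real m" using real_arch_simple by blast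
    then have "?P f N \<le> real m" for N
      using l2_finite_sum_le[OF l2[OF f], of "{..<N}"] unfolding analysis_def by simp
    then show ?thesis unfolding E_def using f by blast
  qed
  then have "\<Union> (range E) = topspace mtopology" unfolding E_def by auto
  then have "mtopology interior_of \<Union> (range E) \<noteq> {}"
    using zero_mem interior_of_topspace[of mtopology] by auto
  moreover have "mtopology interior_of \<Union> (range E) = {}" if "\<And>m. mtopology interior_of E m = {}"
    by (rule metric_Baire_category_alt[OF complete]) (use that closed in auto)
  ultimately obtain m where "mtopology interior_of E m \<noteq> {}" by blast
  then obtain f r where fr: "f \<in> E m" "r > 0" "mball f r \<subseteq> E m"
    unfolding metric_interior_of by blast
  then have f: "f \<in> H" unfolding E_def by blast
  define B where "B = 16 * real m / r\<^sup>2 + 1"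
  have B: "B > 0" unfolding B_def by (simp add: add_nonneg_pos)
  have bound: "?P x N \<le> B * (hnorm ip x)\<^sup>2" if x: "x \<in> H" for x N
  proof (cases "x = 0")
    case True
    then show ?thesis using u by (simp add: ip_zero_left B less_imp_le)
  next
    case False
    then have nx: "hnorm ip x > 0" using x hnorm_eq_0 hnorm_nonneg by force
    \<comment> \<open>the factor 2 keeps \<open>f + t x\<close> inside the open ball\<close>
    define t where "t = r / (2 * hnorm ip x)"
    have t: "t > 0" using nx fr unfolding t_def by simp
    define g where "g = f + of_real t *\<^sub>C x"
    have gH: "g \<in> H" unfolding g_def using x f by (simp add: add_mem scale_mem)
    have "hnorm ip (g - f) = t * hnorm ip x"
      unfolding g_def using x t by (simp add: hnorm_scale)
    also have "\<dots> < r" unfolding t_def using nx fr by simp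
    finally have "g \<in> mball f r"
      using f gH hnorm_minus_commute[OF f gH] by (simp add: hdist_def)
    then have g: "?P g N \<le> real m" using fr unfolding E_def by blast
    have f': "?P f N \<le> real m" using fr unfolding E_def by blast
    have "t\<^sup>2 * ?P x N = (\<Sum>n<N. (cmod (ip g (u n) - ip f (u n)))\<^sup>2)"
      unfolding g_def sum_distrib_left using x f u t
      by (intro sum.cong refl)
        (simp add: ip_add_left ip_scale_left scale_mem norm_mult power_mult_distrib)
    also have "\<dots> \<le> (\<Sum>n<N. 2 * (cmod (ip g (u n)))\<^sup>2 + 2 * (cmod (ip f (u n)))\<^sup>2)"
    proof (rule sum_mono)
      fix n
      let ?a = "cmod (ip g (u n))" and ?b = "cmod (ip f (u n))"
      have "(cmod (ip g (u n) - ip f (u n)))\<^sup>2 \<le> (?a + ?b)\<^sup>2"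
        by (intro power_mono norm_triangle_ineq4) simp
      also have "\<dots> \<le> 2 * ?a\<^sup>2 + 2 * ?b\<^sup>2"
        using sum_squares_bound[of ?a ?b] by (simp add: power2_sum)
      finally show "(cmod (ip g (u n) - ip f (u n)))\<^sup>2 \<le> 2 * ?a\<^sup>2 + 2 * ?b\<^sup>2" .
    qed
    also have "\<dots> = 2 * ?P g N + 2 * ?P f N"
      by (simp add: sum.distrib sum_distrib_left)
    also have "\<dots> \<le> 4 * real m" using g f' by linarith
    finally have "?P x N \<le> 4 * real m / t\<^sup>2"
      using t by (simp add: field_simps)
    also have "\<dots> = 16 * real m / r\<^sup>2 * (hnorm ip x)\<^sup>2"
      unfolding t_def using nx fr by (simp add: power_divide power_mult_distrib field_simps)
    also have "\<dots> \<le> B * (hnorm ip x)\<^sup>2"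
      unfolding B_def by (intro mult_right_mono) auto
    finally show ?thesis .
  qed
  show ?thesis
    unfolding bessel_sequence_def
  proof (intro conjI allI exI[of _ B] ballI)
    fix x assume x: "x \<in> H"
    show sm: "summable (\<lambda>n. (cmod (ip x (u n)))\<^sup>2)"
      using l2[OF x] by (simp add: l2_iff analysis_def)
    show "(\<Sum>n. (cmod (ip x (u n)))\<^sup>2) \<le> B * (hnorm ip x)\<^sup>2"
      by (rule suminf_le_const[OF sm bound[OF x]])
  qed (use u B in auto)
qed

text \<open>
  Pairing the convergent series with \<open>f\<close> shows that the sequence \<open>\<langle>u n, f\<rangle>\<close> has a convergent pairing
  with every square-summable sequence, so it is itself square-summable.
\<close>
lemma (in function_hilbert_space) bessel_sequence_if_synthesis_converges:
  assumes u: "\<And>n. u n \<in> H"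
    and conv: "\<And>c. c \<in> l2 \<Longrightarrow> \<exists>y. hsums H ip (\<lambda>n. c n *\<^sub>C u n) y"
  shows "bessel_sequence H ip u"
proof (rule bessel_sequence_if_analysis_l2[OF u])
  fix f assume f: "f \<in> H"
  have "(\<lambda>n. cnj (ip f (u n))) \<in> l2"
  proof (rule l2_if_all_pairings_summable)
    fix c assume "c \<in> l2"
    then obtain y where "hsums H ip (\<lambda>n. c n *\<^sub>C u n) y" using conv by blast
    then have "(\<lambda>n. c n * cnj (ip f (u n))) sums ip y f" by (rule ip_synthesis(1)[OF u _ f])
    then show "summable (\<lambda>n. c n * cnj (ip f (u n)))" by (rule sums_summable)
  qed
  then show "analysis ip u f \<in> l2" by (simp add: l2_iff analysis_def)
qed

section \<open>Expansions of a bounded operator and of its adjoint\<close>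

context function_hilbert_space
begin

text \<open>
  Both \<open>B f\<close> and the sum of the series on the right have inner product
  \<open>\<Sum> \<langle>f, u n\<rangle> \<langle>g n, x\<rangle>\<close> with every \<open>x\<close>.
\<close>
lemma dual_bessel_expansion:
  assumes u: "bessel_sequence H ip u" and g: "bessel_sequence H ip g"
    and A: "\<And>x. x \<in> H \<Longrightarrow> A x \<in> H" and B: "\<And>x. x \<in> H \<Longrightarrow> B x \<in> H"
    and adj: "\<And>x y. \<lbrakk>x \<in> H; y \<in> H\<rbrakk> \<Longrightarrow> ip (A x) y = ip x (B y)"
    and exp: "\<And>x. x \<in> H \<Longrightarrow> hsums H ip (\<lambda>n. ip x (g n) *\<^sub>C u n) (A x)"
    and f: "f \<in> H"
  shows "hsums H ip (\<lambda>n. ip f (u n) *\<^sub>C g n) (B f)"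
proof -
  have mem: "u n \<in> H" "g n \<in> H" for n using u g by (auto simp: bessel_sequence_def)
  have l2: "analysis ip u x \<in> l2" "analysis ip g x \<in> l2" if "x \<in> H" for x
    using u g that unfolding bessel_sequence_iff_analysis_bounded by blast+
  obtain y where y: "hsums H ip (\<lambda>n. ip f (u n) *\<^sub>C g n) y"
    using bessel_synthesis_converges[OF g l2(1)[OF f]] unfolding analysis_def by blast
  have yH: "y \<in> H" using y by (rule hsums_mem)
  have "y = B f"
  proof (rule eq_if_ip_left_eq[OF yH B[OF f]])
    fix x assume x: "x \<in> H"
    have "ip y x = l2ip (analysis ip u f) (analysis ip g x)"
      unfolding analysis_def[of ip u] ip_synthesis(2)[OF mem(2) y x] ..
    also have "\<dots> = cnj (l2ip (analysis ip g x) (analysis ip u f))"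
      by (intro l2.ip_commute l2 f x)
    also have "l2ip (analysis ip g x) (analysis ip u f) = ip (A x) f"
      unfolding analysis_def[of ip g] ip_synthesis(2)[OF mem(1) exp[OF x] f] ..
    also have "cnj (ip (A x) f) = ip (B f) x"
      unfolding adj[OF x f] by (rule ip_commute[OF B[OF f] x, symmetric])
    finally show "ip y x = ip (B f) x" .
  qed
  then show ?thesis using y by simp
qed

text \<open>
  The lower bound comes from testing the atomic decomposition at \<open>x = L\<^sup>* f\<close>:
  \<open>\<parallel>x\<parallel>\<^sup>2 = \<langle>L x, f\<rangle>\<close> is the pairing of the coefficients of \<open>L x\<close>, whose norm is at most \<open>C \<parallel>x\<parallel>\<close>,
  with the analysis sequence of \<open>f\<close>.
\<close>
lemma atomic_system_imp_analysis_bounds: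
  assumes L: "bounded_operator H ip L" and u: "\<And>n. u n \<in> H" and at: "atomic_system H ip L u"
  shows "\<exists>A>0. \<exists>B>0. \<forall>f\<in>H. analysis ip u f \<in> l2 \<and>
    A * (hnorm ip (adjoint_op H ip L f))\<^sup>2 \<le> (hnorm l2ip (analysis ip u f))\<^sup>2 \<and>
    (hnorm l2ip (analysis ip u f))\<^sup>2 \<le> B * (hnorm ip f)\<^sup>2"
proof -
  have "bessel_sequence H ip u"
    using at u by (intro bessel_sequence_if_synthesis_converges) (auto simp: atomic_system_def)
  then obtain B where "B > 0" and B: "\<And>f. f \<in> H \<Longrightarrow> analysis ip u f \<in> l2 \<and>
      (hnorm l2ip (analysis ip u f))\<^sup>2 \<le> B * (hnorm ip f)\<^sup>2"
    unfolding bessel_sequence_iff_analysis_bounded by blast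
  obtain C where C: "C > 0" and at: "\<And>x. x \<in> H \<Longrightarrow>
      \<exists>a\<in>l2. l2norm a \<le> C * hnorm ip x \<and> hsums H ip (\<lambda>n. a n *\<^sub>C u n) (L x)"
    using at unfolding atomic_system_def by blast
  have "1 / C\<^sup>2 * (hnorm ip (adjoint_op H ip L f))\<^sup>2 \<le> (hnorm l2ip (analysis ip u f))\<^sup>2"
    if f: "f \<in> H" for f
  proof -
    define x where "x = adjoint_op H ip L f"
    have x: "x \<in> H" and adj: "ip (L x) f = ip x x"
      using adjoint_op_mem_and_ip[OF L f] unfolding x_def by auto
    have nx: "hnorm ip x \<ge> 0" using x by (rule hnorm_nonneg)
    have nu: "hnorm l2ip (analysis ip u f) \<ge> 0" using B[OF f] l2.hnorm_nonneg by blast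
    obtain a where a: "a \<in> l2" "l2norm a \<le> C * hnorm ip x"
      and sums: "hsums H ip (\<lambda>n. a n *\<^sub>C u n) (L x)" using at[OF x] by blast
    have "hnorm ip x * hnorm ip x = cmod (ip x x)"
      using x nx by (simp add: ip_self norm_power norm_mult power2_eq_square)
    also have "ip x x = l2ip a (analysis ip u f)"
      using ip_synthesis(2)[OF u sums f] adj by simp
    also have "cmod \<dots> \<le> hnorm l2ip a * hnorm l2ip (analysis ip u f)"
      using a B[OF f] by (intro l2.Cauchy_Schwarz) auto
    also have "\<dots> \<le> (C * hnorm ip x) * hnorm l2ip (analysis ip u f)"
      using a nu l2norm_eq_hnorm[OF a(1)] by (intro mult_right_mono) auto
    finally have "hnorm ip x * hnorm ip x \<le> hnorm ip x * (C * hnorm l2ip (analysis ip u f))"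
      by (simp add: mult_ac)
    then have "hnorm ip x \<le> C * hnorm l2ip (analysis ip u f)"
      using nx nu C by (cases "hnorm ip x = 0") auto
    then have "(hnorm ip x)\<^sup>2 \<le> (C * hnorm l2ip (analysis ip u f))\<^sup>2"
      using nx by (intro power_mono)
    then show ?thesis
      unfolding x_def[symmetric] using C by (simp add: power_mult_distrib field_simps)
  qed
  moreover have "1 / C\<^sup>2 > 0" using C by simp
  ultimately show ?thesis using B \<open>B > 0\<close> by blast
qed

text \<open>
  The factorisation of \<open>L\<close> through the synthesis operator of \<open>u\<close>, in the spirit of Douglas' range
  inclusion theorem.  For fixed \<open>x\<close>, the lower bound makes \<open>\<langle>f, L x\<rangle>\<close> depend only on the sequence
  \<open>analysis ip u f\<close>, and boundedly so; its Riesz representer \<open>a x\<close> over the range of the analysis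
  map is a coefficient sequence for \<open>L x\<close>.  Because representers over a subspace are unique,
  \<open>a x\<close> is linear in \<open>x\<close>, and a second application of Riesz turns its coordinates into inner
  products \<open>\<langle>x, g n\<rangle>\<close>.
\<close>
lemma bessel_expansion_if_adjoint_dominated:
  assumes L: "bounded_operator H ip L" and u: "bessel_sequence H ip u" and A: "A > 0"
    and lower: "\<And>f. f \<in> H \<Longrightarrow>
      A * (hnorm ip (adjoint_op H ip L f))\<^sup>2 \<le> (hnorm l2ip (analysis ip u f))\<^sup>2"
  obtains g where "bessel_sequence H ip g"
    "\<And>f. f \<in> H \<Longrightarrow> hsums H ip (\<lambda>n. ip f (g n) *\<^sub>C u n) (L f)"
proof -
  define S where "S = analysis ip u ` H"
  have mem: "u n \<in> H" for n using u by (auto simp: bessel_sequence_def)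
  have l2: "analysis ip u x \<in> l2" if "x \<in> H" for x
    using u that unfolding bessel_sequence_iff_analysis_bounded by blast
  have Lmem: "L x \<in> H" if "x \<in> H" for x using L that by (simp add: bounded_operator_def)
  have adj_mem: "adjoint_op H ip L f \<in> H" if "f \<in> H" for f
    using adjoint_op_mem_and_ip[OF L that] by blast
  have Sl2: "S \<subseteq> l2" unfolding S_def using l2 by blast
  have S: "cfun.subspace S"
    unfolding cfun.subspace_def
  proof (intro conjI ballI allI)
    have "analysis ip u 0 = 0" using mem by (simp add: analysis_def fun_eq_iff ip_zero_left)
    then show "0 \<in> S" unfolding S_def using zero_mem by (metis image_eqI)
    show "s + t \<in> S" if "s \<in> S" "t \<in> S" for s t
      using that unfolding S_def by (auto simp flip: analysis_add[OF mem] intro: add_mem)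
    show "c *\<^sub>C s \<in> S" if "s \<in> S" for c s
      using that unfolding S_def by (auto simp flip: analysis_scale[OF mem] intro: scale_mem)
  qed
  have dominated: "cmod (ip f (L x)) \<le> hnorm ip x / sqrt A * hnorm l2ip (analysis ip u f)"
    if f: "f \<in> H" and x: "x \<in> H" for f x
  proof -
    let ?n = "hnorm ip (adjoint_op H ip L f)"
    have n: "?n \<ge> 0" using adj_mem[OF f] by (rule hnorm_nonneg)
    have "(sqrt A * ?n)\<^sup>2 \<le> (hnorm l2ip (analysis ip u f))\<^sup>2"
      using lower[OF f] A by (simp add: power_mult_distrib)
    then have "sqrt A * ?n \<le> hnorm l2ip (analysis ip u f)"
      using l2.hnorm_nonneg[OF l2[OF f]] by (rule power2_le_imp_le)
    then have le: "?n \<le> hnorm l2ip (analysis ip u f) / sqrt A"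
      using A by (simp add: field_simps)
    have "cmod (ip f (L x)) = cmod (ip (L x) f)"
      using ip_commute[OF f Lmem[OF x]] by simp
    also have "ip (L x) f = ip x (adjoint_op H ip L f)"
      using adjoint_op_mem_and_ip[OF L f] x by blast
    also have "cmod \<dots> \<le> hnorm ip x * ?n"
      by (rule Cauchy_Schwarz[OF x adj_mem[OF f]])
    also have "\<dots> \<le> hnorm ip x * (hnorm l2ip (analysis ip u f) / sqrt A)"
      using le hnorm_nonneg[OF x] by (rule mult_left_mono)
    finally show ?thesis by simp
  qed
  \<comment> \<open>the last clause puts \<open>a\<close> into the closure of \<open>S\<close>; it is what makes \<open>a\<close> unique\<close>
  define rep where "rep = (\<lambda>x a. a \<in> l2 \<and> (\<forall>f\<in>H. l2ip (analysis ip u f) a = ip f (L x)) \<and>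
      (\<forall>d\<in>l2. (\<forall>f\<in>H. l2ip (analysis ip u f) d = 0) \<longrightarrow> l2ip a d = 0))"
  have "\<exists>a. rep x a \<and> hnorm l2ip a \<le> hnorm ip x / sqrt A" if x: "x \<in> H" for x
  proof -
    \<comment> \<open>the choice of the preimage is immaterial, since \<open>dominated\<close> kills the kernel of the analysis map\<close>
    define \<phi> where "\<phi> = (\<lambda>s. ip (SOME f. f \<in> H \<and> analysis ip u f = s) (L x))"
    have \<phi>: "\<phi> (analysis ip u f) = ip f (L x)" if f: "f \<in> H" for f
    proof -
      define f' where "f' = (SOME f'. f' \<in> H \<and> analysis ip u f' = analysis ip u f)"
      have f': "f' \<in> H" "analysis ip u f' = analysis ip u f"
        using someI[of "\<lambda>f'. f' \<in> H \<and> analysis ip u f' = analysis ip u f" f] f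
        unfolding f'_def by auto
      have "analysis ip u (f' - f) = 0"
        using f f' by (simp add: analysis_diff[OF mem])
      then have "hnorm l2ip (analysis ip u (f' - f)) = 0"
        using l2.hnorm_eq_0[OF l2.zero_mem] by simp
      then have "ip (f' - f) (L x) = 0"
        using dominated[OF diff_mem[OF f'(1) f] x] by simp
      then show ?thesis
        using f f' x Lmem unfolding \<phi>_def f'_def[symmetric] by (simp add: ip_diff_left)
    qed
    have add: "\<phi> (s + t) = \<phi> s + \<phi> t" if st: "s \<in> S" "t \<in> S" for s t
    proof -
      obtain f h where fh: "f \<in> H" "h \<in> H" "s = analysis ip u f" "t = analysis ip u h"
        using st unfolding S_def by blast
      then have "\<phi> (s + t) = \<phi> (analysis ip u (f + h))" by (simp add: analysis_add[OF mem])
      also have "\<dots> = ip f (L x) + ip h (L x)"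
        using fh x Lmem by (simp add: \<phi> add_mem ip_add_left)
      finally show ?thesis using fh by (simp add: \<phi>)
    qed
    have scale: "\<phi> (c *\<^sub>C s) = c * \<phi> s" if s: "s \<in> S" for c s
    proof -
      obtain f where f: "f \<in> H" "s = analysis ip u f" using s unfolding S_def by blast
      then have "\<phi> (c *\<^sub>C s) = \<phi> (analysis ip u (c *\<^sub>C f))" by (simp add: analysis_scale[OF mem])
      also have "\<dots> = c * ip f (L x)"
        using f x Lmem by (simp add: \<phi> scale_mem ip_scale_left)
      finally show ?thesis using f by (simp add: \<phi>)
    qed
    have bound: "cmod (\<phi> s) \<le> hnorm ip x / sqrt A * hnorm l2ip s" if "s \<in> S" for s
      using that dominated[OF _ x] unfolding S_def by (auto simp: \<phi>)
    have "0 \<le> hnorm ip x / sqrt A" using A x by (simp add: hnorm_nonneg)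
    then obtain a where a: "a \<in> l2" "\<And>s. s \<in> S \<Longrightarrow> \<phi> s = l2ip s a"
      "\<And>d. \<lbrakk>d \<in> l2; \<And>s. s \<in> S \<Longrightarrow> l2ip s d = 0\<rbrakk> \<Longrightarrow> l2ip a d = 0"
      "hnorm l2ip a \<le> hnorm ip x / sqrt A"
      using l2.riesz_on_subspace[of S \<phi>, OF S Sl2 add scale bound] by metis
    have "rep x a"
      unfolding rep_def
    proof (intro conjI ballI impI)
      show "l2ip (analysis ip u f) a = ip f (L x)" if "f \<in> H" for f
        using a(2)[of "analysis ip u f"] \<phi>[OF that] that unfolding S_def by simp
      show "l2ip a d = 0" if "d \<in> l2" "\<forall>f\<in>H. l2ip (analysis ip u f) d = 0" for d
        by (rule a(3)[OF that(1)]) (use that(2) in \<open>auto simp: S_def\<close>)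
    qed (rule a(1))
    then show ?thesis using a(4) by blast
  qed
  then obtain a where rep: "\<And>x. x \<in> H \<Longrightarrow> rep x (a x)"
    and norm_a: "\<And>x. x \<in> H \<Longrightarrow> hnorm l2ip (a x) \<le> hnorm ip x / sqrt A"
    by metis
  have al2: "a x \<in> l2" if "x \<in> H" for x using rep[OF that] unfolding rep_def by blast
  have rep_ip: "l2ip (analysis ip u f) (a x) = ip f (L x)" if "f \<in> H" "x \<in> H" for f x
    using rep[OF that(2)] that(1) unfolding rep_def by blast
  have rep_unique: "b = b'" if "rep x b" "rep x b'" for x b b'
  proof -
    have b: "b \<in> l2" "b' \<in> l2" using that unfolding rep_def by auto
    have d: "b - b' \<in> l2" by (rule l2.diff_mem[OF b])
    have "l2ip (analysis ip u f) (b - b') = 0" if "f \<in> H" for f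
      using \<open>rep x b\<close> \<open>rep x b'\<close> that b l2[OF that] unfolding rep_def
      by (simp add: l2.ip_diff_right)
    then have "l2ip b (b - b') = 0" "l2ip b' (b - b') = 0"
      using that d unfolding rep_def by blast+
    then have "l2ip (b - b') (b - b') = 0" using b d by (simp add: l2.ip_diff_left)
    then have "b - b' = 0" using d by (intro l2.ip_definite)
    then show ?thesis by simp
  qed
  have a_add: "a (x + y) = a x + a y" if x: "x \<in> H" and y: "y \<in> H" for x y
  proof (rule rep_unique)
    show "rep (x + y) (a (x + y))" using x y by (intro rep add_mem)
    have "L (x + y) = L x + L y" using L x y by (simp add: bounded_operator_def)
    then show "rep (x + y) (a x + a y)"
      using rep[OF x] rep[OF y] x y unfolding rep_def
      by (simp add: l2.add_mem l2 l2.ip_add_right l2.ip_add_left ip_add_right Lmem)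
  qed
  have a_scale: "a (c *\<^sub>C x) = c *\<^sub>C a x" if x: "x \<in> H" for c x
  proof (rule rep_unique)
    show "rep (c *\<^sub>C x) (a (c *\<^sub>C x))" using x by (intro rep scale_mem)
    have "L (c *\<^sub>C x) = c *\<^sub>C L x" using L x by (simp add: bounded_operator_def)
    then show "rep (c *\<^sub>C x) (c *\<^sub>C a x)"
      using rep[OF x] x unfolding rep_def
      by (simp add: l2.scale_mem l2 l2.ip_scale_right l2.ip_scale_left ip_scale_right Lmem)
  qed
  have "\<exists>h. h \<in> H \<and> (\<forall>x\<in>H. a x n = ip x h)" for n
  proof -
    have add: "a (x + y) n = a x n + a y n" if "x \<in> H" "y \<in> H" for x y
      using that by (simp add: a_add)
    have scale: "a (c *\<^sub>C x) n = c * a x n" if "x \<in> H" for c x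
      using that by (simp add: a_scale) (simp add: cscale_def)
    have bound: "cmod (a x n) \<le> 1 / sqrt A * hnorm ip x" if "x \<in> H" for x
      using l2_coordinate_le[OF al2[OF that], of n] norm_a[OF that] by simp
    have "0 \<le> 1 / sqrt A" using A by simp
    then show ?thesis
      using riesz_on_subspace[of H "\<lambda>x. a x n", OF subspace_H subset_refl add scale bound]
      by metis
  qed
  then obtain g where g: "\<And>n. g n \<in> H" and coord: "\<And>n x. x \<in> H \<Longrightarrow> a x n = ip x (g n)"
    by metis
  have a_eq: "analysis ip g x = a x" if "x \<in> H" for x
    using coord[OF that] by (simp add: analysis_def fun_eq_iff)
  have "bessel_sequence H ip g"
    unfolding bessel_sequence_iff_analysis_bounded
  proof (intro conjI allI exI[of _ "1 / A"] ballI)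
    fix x assume x: "x \<in> H"
    show "analysis ip g x \<in> l2" using al2 a_eq x by simp
    have "(hnorm l2ip (a x))\<^sup>2 \<le> (hnorm ip x / sqrt A)\<^sup>2"
      by (intro power_mono norm_a x l2.hnorm_nonneg al2)
    then show "(hnorm l2ip (analysis ip g x))\<^sup>2 \<le> 1 / A * (hnorm ip x)\<^sup>2"
      using A by (simp add: a_eq x power_divide)
  qed (use g A in auto)
  moreover have "hsums H ip (\<lambda>n. ip x (g n) *\<^sub>C u n) (L x)" if x: "x \<in> H" for x
  proof -
    obtain y where y: "hsums H ip (\<lambda>n. a x n *\<^sub>C u n) y"
      using bessel_synthesis_converges[OF u al2[OF x]] by blast
    have "y = L x"
    proof (rule eq_if_ip_left_eq[OF hsums_mem[OF y] Lmem[OF x]])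
      fix f assume f: "f \<in> H"
      have "ip y f = l2ip (a x) (analysis ip u f)" by (rule ip_synthesis(2)[OF mem y f])
      also have "\<dots> = cnj (ip f (L x))"
        unfolding rep_ip[OF f x, symmetric] by (intro l2.ip_commute al2 l2 x f)
      also have "\<dots> = ip (L x) f" by (rule ip_commute[OF Lmem[OF x] f, symmetric])
      finally show "ip y f = ip (L x) f" .
    qed
    then show ?thesis using y coord[OF x] by simp
  qed
  ultimately show thesis by (rule that)
qed

lemma atomic_system_if_bessel_expansion:
  assumes u: "bessel_sequence H ip u" and g: "bessel_sequence H ip g"
    and exp: "\<And>f. f \<in> H \<Longrightarrow> hsums H ip (\<lambda>n. ip f (g n) *\<^sub>C u n) (L f)"
  shows "atomic_system H ip L u"
  unfolding atomic_system_def
proof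
  show "\<forall>c\<in>l2. \<exists>y. hsums H ip (\<lambda>n. c n *\<^sub>C u n) y"
    using bessel_synthesis_converges[OF u] by blast
  obtain B where "B > 0" and B: "\<And>f. f \<in> H \<Longrightarrow> analysis ip g f \<in> l2 \<and>
      (hnorm l2ip (analysis ip g f))\<^sup>2 \<le> B * (hnorm ip f)\<^sup>2"
    using g unfolding bessel_sequence_iff_analysis_bounded by blast
  have "\<exists>a\<in>l2. l2norm a \<le> sqrt B * hnorm ip f \<and> hsums H ip (\<lambda>n. a n *\<^sub>C u n) (L f)"
    if f: "f \<in> H" for f
  proof (intro bexI[of _ "analysis ip g f"] conjI)
    show l2: "analysis ip g f \<in> l2" using B f by blast
    have "(hnorm l2ip (analysis ip g f))\<^sup>2 \<le> (sqrt B * hnorm ip f)\<^sup>2"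
      using B[OF f] \<open>B > 0\<close> by (simp add: power_mult_distrib)
    then show "l2norm (analysis ip g f) \<le> sqrt B * hnorm ip f"
      unfolding l2norm_eq_hnorm[OF l2]
      by (rule power2_le_imp_le) (use \<open>B > 0\<close> f in \<open>simp add: hnorm_nonneg\<close>)
    show "hsums H ip (\<lambda>n. analysis ip g f n *\<^sub>C u n) (L f)"
      using exp[OF f] by (simp add: analysis_def)
  qed
  then show "\<exists>C>0. \<forall>x\<in>H. \<exists>a\<in>l2. l2norm a \<le> C * hnorm ip x \<and> hsums H ip (\<lambda>n. a n *\<^sub>C u n) (L x)"
    using \<open>B > 0\<close> by (intro exI[of _ "sqrt B"]) simp
qed

end

section \<open>Normalised kernels\<close>

context rkhs
begin

lemma normalized_kernel_mem: "l \<in> \<Omega> \<Longrightarrow> normalized_kernel ip K l \<in> H"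
  unfolding normalized_kernel_def by (intro scale_mem kernel_mem)

lemma ip_normalized_kernel:
  "\<lbrakk>f \<in> H; l \<in> \<Omega>\<rbrakk> \<Longrightarrow> ip f (normalized_kernel ip K l) = f l / of_real (hnorm ip (\<lambda>z. K z l))"
  unfolding normalized_kernel_def
  by (simp add: ip_scale_right kernel_mem reproducing[symmetric])

end

theorem theorem4:
  fixes \<Omega> :: "'a set"
    and H :: "('a \<Rightarrow> complex) set"
    and ip :: "('a \<Rightarrow> complex) \<Rightarrow> ('a \<Rightarrow> complex) \<Rightarrow> complex"
    and K :: "'a \<Rightarrow> 'a \<Rightarrow> complex"
    and L :: "('a \<Rightarrow> complex) \<Rightarrow> 'a \<Rightarrow> complex"
    and lam :: "nat \<Rightarrow> 'a"
  assumes "\<Omega> \<noteq> {}"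
    and "rkhs \<Omega> H ip K"
    and "separable_space (Metric_space.mtopology H (hdist H ip))"
    and "bounded_operator H ip L"
    and "\<And>n. lam n \<in> \<Omega>"
    and "\<And>n m. n \<noteq> m \<Longrightarrow> lam n \<noteq> lam m"
    and "\<And>n. (\<lambda>z. K z (lam n)) \<noteq> 0"
  shows "let
      k = (\<lambda>n. normalized_kernel ip K (lam n));
      nK = (\<lambda>n. hnorm ip (\<lambda>z. K z (lam n)));
      st_i = atomic_system H ip L k;
      st_ii = (\<exists>A>0. \<exists>B>0. \<forall>f\<in>H.
          summable (\<lambda>n. (cmod (f (lam n)))\<^sup>2 / (nK n)\<^sup>2) \<and>
          A * (hnorm ip (adjoint_op H ip L f))\<^sup>2 \<le> (\<Sum>n. (cmod (f (lam n)))\<^sup>2 / (nK n)\<^sup>2) \<and>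
          (\<Sum>n. (cmod (f (lam n)))\<^sup>2 / (nK n)\<^sup>2) \<le> B * (hnorm ip f)\<^sup>2);
      st_iii = (bessel_sequence H ip k \<and>
          (\<exists>g. bessel_sequence H ip g \<and>
            (\<forall>f\<in>H. hsums H ip (\<lambda>n. ip f (g n) *\<^sub>C k n) (L f))));
      st_iv = ((\<forall>f\<in>H. summable (\<lambda>n. (cmod (f (lam n)))\<^sup>2 / (nK n)\<^sup>2)) \<and>
          (\<exists>g. bessel_sequence H ip g \<and>
            (\<forall>f\<in>H. hsums H ip (\<lambda>n. (f (lam n) / of_real (nK n)) *\<^sub>C g n)
                      (adjoint_op H ip L f))))
    in (st_i \<longleftrightarrow> st_ii) \<and> (st_ii \<longleftrightarrow> st_iii) \<and> (st_iii \<longleftrightarrow> st_iv)"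
proof -
  interpret rkhs \<Omega> H ip K by (rule assms(2))
  note L = assms(4)
  let ?L' = "adjoint_op H ip L"
  have Lmem: "L x \<in> H" if "x \<in> H" for x using L that by (simp add: bounded_operator_def)
  have adj_mem: "?L' x \<in> H" if "x \<in> H" for x using adjoint_op_mem_and_ip[OF L that] by blast
  have adj: "ip (L x) y = ip x (?L' y)" if "x \<in> H" "y \<in> H" for x y
    using adjoint_op_mem_and_ip[OF L that(2)] that(1) by blast
  have adj': "ip (?L' x) y = ip x (L y)" if "x \<in> H" "y \<in> H" for x y
    using adj[OF that(2,1)] that Lmem adj_mem ip_commute by metis
  define k where "k = (\<lambda>n. normalized_kernel ip K (lam n))"
  define nK where "nK = (\<lambda>n. hnorm ip (\<lambda>z. K z (lam n)))"
  have k: "k n \<in> H" for n unfolding k_def by (intro normalized_kernel_mem assms)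
  have coeff: "f (lam n) / of_real (nK n) = ip f (k n)" if "f \<in> H" for f n
    unfolding k_def nK_def using that assms by (simp add: ip_normalized_kernel)
  have square: "(cmod (f (lam n)))\<^sup>2 / (nK n)\<^sup>2 = (cmod (analysis ip k f n))\<^sup>2" if "f \<in> H" for f n
    unfolding analysis_def coeff[OF that, symmetric] by (simp add: norm_divide power_divide)
  define st_i where "st_i = atomic_system H ip L k"
  define st_ii where "st_ii = (\<exists>A>0. \<exists>B>0. \<forall>f\<in>H. analysis ip k f \<in> l2 \<and>
      A * (hnorm ip (?L' f))\<^sup>2 \<le> (hnorm l2ip (analysis ip k f))\<^sup>2 \<and>
      (hnorm l2ip (analysis ip k f))\<^sup>2 \<le> B * (hnorm ip f)\<^sup>2)"
  define st_iii where "st_iii = (bessel_sequence H ip k \<and> (\<exists>g. bessel_sequence H ip g \<and>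
      (\<forall>f\<in>H. hsums H ip (\<lambda>n. ip f (g n) *\<^sub>C k n) (L f))))"
  define st_iv where "st_iv = ((\<forall>f\<in>H. analysis ip k f \<in> l2) \<and> (\<exists>g. bessel_sequence H ip g \<and>
      (\<forall>f\<in>H. hsums H ip (\<lambda>n. ip f (k n) *\<^sub>C g n) (?L' f))))"
  have "st_i \<Longrightarrow> st_ii"
    unfolding st_i_def st_ii_def by (rule atomic_system_imp_analysis_bounds[OF L k])
  moreover have "st_iii" if st: st_ii
  proof -
    obtain A B where "A > 0" "B > 0" and AB: "\<And>f. f \<in> H \<Longrightarrow> analysis ip k f \<in> l2 \<and>
        A * (hnorm ip (?L' f))\<^sup>2 \<le> (hnorm l2ip (analysis ip k f))\<^sup>2 \<and>
        (hnorm l2ip (analysis ip k f))\<^sup>2 \<le> B * (hnorm ip f)\<^sup>2"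
      using st unfolding st_ii_def by blast
    have k': "bessel_sequence H ip k"
      unfolding bessel_sequence_iff_analysis_bounded using k AB \<open>B > 0\<close> by blast
    have lower: "A * (hnorm ip (?L' f))\<^sup>2 \<le> (hnorm l2ip (analysis ip k f))\<^sup>2" if "f \<in> H" for f
      using AB[OF that] by blast
    obtain g where "bessel_sequence H ip g"
      "\<And>f. f \<in> H \<Longrightarrow> hsums H ip (\<lambda>n. ip f (g n) *\<^sub>C k n) (L f)"
      using bessel_expansion_if_adjoint_dominated[OF L k' \<open>A > 0\<close> lower] by blast
    then show ?thesis unfolding st_iii_def using k' by blast
  qed
  moreover have "st_iii \<Longrightarrow> st_i"
    unfolding st_iii_def st_i_def using atomic_system_if_bessel_expansion by blast
  moreover have "st_iv" if st: st_iii
  proof -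
    obtain g where k': "bessel_sequence H ip k" and g: "bessel_sequence H ip g"
      and exp: "\<And>f. f \<in> H \<Longrightarrow> hsums H ip (\<lambda>n. ip f (g n) *\<^sub>C k n) (L f)"
      using st unfolding st_iii_def by blast
    have "hsums H ip (\<lambda>n. ip f (k n) *\<^sub>C g n) (?L' f)" if "f \<in> H" for f
      by (rule dual_bessel_expansion[where A = L and B = ?L', OF k' g Lmem adj_mem adj exp that])
    then show ?thesis
      using k' g unfolding st_iv_def bessel_sequence_iff_analysis_bounded[of k] by blast
  qed
  moreover have "st_iii" if st: st_iv
  proof -
    obtain g where l2: "\<And>f. f \<in> H \<Longrightarrow> analysis ip k f \<in> l2" and g: "bessel_sequence H ip g"
      and exp: "\<And>f. f \<in> H \<Longrightarrow> hsums H ip (\<lambda>n. ip f (k n) *\<^sub>C g n) (?L' f)"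
      using st unfolding st_iv_def by blast
    have k': "bessel_sequence H ip k" by (rule bessel_sequence_if_analysis_l2[OF k l2])
    have "hsums H ip (\<lambda>n. ip f (g n) *\<^sub>C k n) (L f)" if "f \<in> H" for f
      by (rule dual_bessel_expansion[where A = ?L' and B = L, OF g k' adj_mem Lmem adj' exp that])
    then show ?thesis using k' g unfolding st_iii_def by blast
  qed
  ultimately have equiv: "(st_i \<longleftrightarrow> st_ii) \<and> (st_ii \<longleftrightarrow> st_iii) \<and> (st_iii \<longleftrightarrow> st_iv)" by blast
  have ii: "st_ii \<longleftrightarrow> (\<exists>A>0. \<exists>B>0. \<forall>f\<in>H.
      summable (\<lambda>n. (cmod (f (lam n)))\<^sup>2 / (nK n)\<^sup>2) \<and>
      A * (hnorm ip (?L' f))\<^sup>2 \<le> (\<Sum>n. (cmod (f (lam n)))\<^sup>2 / (nK n)\<^sup>2) \<and>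
      (\<Sum>n. (cmod (f (lam n)))\<^sup>2 / (nK n)\<^sup>2) \<le> B * (hnorm ip f)\<^sup>2)"
    unfolding st_ii_def
    by (intro ex_cong1 conj_cong ball_cong refl) (auto simp: square l2_iff l2_hnorm_square)
  have iv: "st_iv \<longleftrightarrow> (\<forall>f\<in>H. summable (\<lambda>n. (cmod (f (lam n)))\<^sup>2 / (nK n)\<^sup>2)) \<and>
      (\<exists>g. bessel_sequence H ip g \<and>
        (\<forall>f\<in>H. hsums H ip (\<lambda>n. (f (lam n) / of_real (nK n)) *\<^sub>C g n) (?L' f)))"
    unfolding st_iv_def
    by (intro ex_cong1 conj_cong ball_cong refl) (simp_all add: square coeff l2_iff)
  show ?thesis
    using equiv unfolding Let_def ii iv unfolding st_i_def st_iii_def k_def nK_def .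
qed

end
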